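(* Let $2\le k<\omega$ and let $\mathcal{G}_k$ be generic for $\mathcal{P}(\omega^k)/\mathrm{Fin}^{\otimes k}$. In $V[\mathcal{G}_k]$, for each monotone function $g:\mathcal{G}_k\to\mathcal{P}(\omega)$ there is $Y\in\mathcal{B}_k$ such that $g\restriction(\mathcal{B}_k|Y)$ is basic.
   Context: $\mathrm{Fin}^{\otimes 1}$ is the ideal of finite subsets of $\omega$; $\mathrm{Fin}^{\otimes(k+1)}$ is the ideal of $X\subseteq\omega^{k+1}$ such that for all but finitely many $i$, $\{(j_1,\dots,j_k):(i,j_1,\dots,j_k)\in X\}\in\mathrm{Fin}^{\otimes k}$. $\mathcal{G}_k$ is an ultrafilter on $\omega^k$; $[\omega]^k$ is identified with the strictly increasing $k$-tuples in $\omega^k$. Monotone means $X\subseteq Y\Rightarrow g(X)\subseteq g(Y)$. The space $\mathcal{E}_k$: let $\omega^{\not\downarrow\le k}$ be the non-decreasing sequences of naturals of length $\le k$ (including $()$), $\omega^{\not\downarrow k}$ those of length $k$. Well-order $\omega^{\not\downarrow\le k}$ by $\prec$: $()$ least; for nonempty $(j_0,\dots,j_{p-1}),(l_0,\dots,l_{q-1})$, $\prec$ holds iff $j_{p-1}<l_{q-1}$, or $j_{p-1}=l_{q-1}$ and the first is lexicographically below the second (proper initial segments count as below). $\vec j_m$ is its $m$-th element, $m_{\vec l}$ the index of $\vec l$, $\vec i_n$ the $n$-th element of $\omega^{\not\downarrow k}$. $\mathbb{W}_k(\vec j)=\{m_{\vec j\restriction q}:1\le q\le|\vec j|\}$, $\widehat{\mathbb{W}}_k=\{\mathbb{W}_k(\vec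 j)\}$. An $\mathcal{E}_k$-tree is $\hat X:\omega^{\not\downarrow\le k}\to\widehat{\mathbb{W}}_k$ with (i) $|\hat X(\vec j_m)|=|\vec j_m|$; (ii) $\max\hat X(\vec j_m)<\max\hat X(\vec j_{m+1})$ for $m\ge1$; (iii) $\hat X(\vec j_m)$ is a proper initial segment of $\hat X(\vec j_n)$ iff $\vec j_m$ is a proper initial segment of $\vec j_n$. $\mathcal{E}_k$ consists of the restrictions $X=\hat X\restriction\omega^{\not\downarrow k}$, identified with their ranges ($\subseteq[\omega]^k$). $Y\le X$ iff $Y\subseteq X$. $r_n(X)=\{X(\vec i_p):p<n\}$, $\mathcal{AR}=\{r_n(X):X\in\mathcal{E}_k,n<\omega\}$; $s\sqsubset t$ means $s=r_m(t)$ for some $m<|t|$. $\mathcal{AR}|Y=\{a\in\mathcal{AR}:a\subseteq Y\}$. $\mathcal{B}_k=\mathcal{G}_k\cap\mathcal{E}_k$ and $\mathcal{B}_k|Y=\{V\in\mathcal{B}_k:V\le Y\}$. Basic: a monotone $g:\mathcal{B}_k|Y\to\mathcal{P}(\omega)$ is basic if there is $\hat g:\mathcal{AR}|Y\to[\omega]^{<\omega}$ such that (1) $s\subseteq t$ implies $\hat g(s)\subseteq\hat g(t)$; (2) $s\sqsubset t$ implies $\hat g(s)$ is an initial segment of $\hat g(t)$; (3) $g(V)=\bigcup_{n<\omega}\hat g(r_n(V))$ for every $V\in\mathcal{B}_k|Y$.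
   Formalization: The claim is proved for generics with B_k nonempty: read literally, a generic containing the Fin^{⊗k}-positive set of tuples whose first entry is not of the form m_{(j)} has B_k empty, so no Y in B_k exists although monotone g do. *)

theory Defs
  imports Main "HOL-Library.Sublist"
begin

section \<open>The forcing language\<close>

text \<open>
  The ground model V is the ambient universe. A sentence of the forcing language is represented
  by its forcing relation: \<open>\<phi> L p\<close> says that the condition \<open>p\<close> of the forcing notion \<open>L\<close> forces
  \<open>\<phi>\<close>. A forcing notion is given by its preorder \<open>L\<close> (\<open>L q p\<close>: \<open>q\<close> is stronger than \<open>p\<close>),
  the conditions being the \<open>p\<close> with \<open>L p p\<close>. The connectives follow the usual recursive clauses
  of the forcing relation. Variables of quantifiers range over names, where an
  element of a ground model set serves as its own (check) name.
\<close>

type_synonym 'c sentence = "('c \<Rightarrow> 'c \<Rightarrow> bool) \<Rightarrow> 'c \<Rightarrow> bool"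

text \<open>For statements about ground model objects that are absolute between V and V[G].\<close>

definition fGround :: "bool \<Rightarrow> 'c sentence" ("\<langle>_\<rangle>") where
  "\<langle>b\<rangle> = (\<lambda>L p. b)"

definition fAnd :: "'c sentence \<Rightarrow> 'c sentence \<Rightarrow> 'c sentence" (infixr "\<^bold>\<and>" 35) where
  "(\<phi> \<^bold>\<and> \<psi>) = (\<lambda>L p. \<phi> L p \<and> \<psi> L p)"

definition fImp :: "'c sentence \<Rightarrow> 'c sentence \<Rightarrow> 'c sentence" (infixr "\<^bold>\<longrightarrow>" 25) where
  "(\<phi> \<^bold>\<longrightarrow> \<psi>) = (\<lambda>L p. \<forall>q. L q p \<longrightarrow> \<phi> L q \<longrightarrow> \<psi> L q)"

definition fIff :: "'c sentence \<Rightarrow> 'c sentence \<Rightarrow> 'c sentence" (infixr "\<^bold>\<longleftrightarrow>" 25) where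
  "(\<phi> \<^bold>\<longleftrightarrow> \<psi>) = ((\<phi> \<^bold>\<longrightarrow> \<psi>) \<^bold>\<and> (\<psi> \<^bold>\<longrightarrow> \<phi>))"

definition fAll :: "('x \<Rightarrow> 'c sentence) \<Rightarrow> 'c sentence" (binder "\<^bold>\<forall>" 10) where
  "(\<^bold>\<forall>x. \<phi> x) = (\<lambda>L p. \<forall>x. \<phi> x L p)"

definition fEx :: "('x \<Rightarrow> 'c sentence) \<Rightarrow> 'c sentence" (binder "\<^bold>\<exists>" 10) where
  "(\<^bold>\<exists>x. \<phi> x) = (\<lambda>L p. \<forall>q. L q p \<longrightarrow> (\<exists>r. L r q \<and> (\<exists>x. \<phi> x L r)))"

definition forced :: "('c \<Rightarrow> 'c \<Rightarrow> bool) \<Rightarrow> 'c sentence \<Rightarrow> bool" (infix "\<tturnstile>" 5) where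
  "(L \<tturnstile> \<phi>) \<longleftrightarrow> (\<forall>p. L p p \<longrightarrow> \<phi> L p)"

text \<open>
  A name is a set of pairs (name of an element, condition). The first argument of \<open>fmem\<close> is
  equality of V[G] on the names of elements.
\<close>

type_synonym ('x, 'c) name = "('x \<times> 'c) set"

definition fmem :: "('x \<Rightarrow> 'x \<Rightarrow> 'c sentence) \<Rightarrow> 'x \<Rightarrow> ('x, 'c) name \<Rightarrow> 'c sentence" where
  "fmem eq x \<tau> =
    (\<lambda>L p. \<forall>q. L q p \<longrightarrow> (\<exists>r. L r q \<and> (\<exists>(y, s) \<in> \<tau>. L r s \<and> eq x y L r)))"

text \<open>Names for subsets of ground model sets.\<close>

definition fin_set :: "'a \<Rightarrow> ('a, 'c) name \<Rightarrow> 'c sentence" (infix "\<^bold>\<in>" 50) where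
  "(a \<^bold>\<in> X) = fmem (\<lambda>a b. \<langle>a = b\<rangle>) a X"

definition fsubset :: "('a, 'c) name \<Rightarrow> ('a, 'c) name \<Rightarrow> 'c sentence" (infix "\<^bold>\<subseteq>" 50) where
  "(X \<^bold>\<subseteq> Y) = (\<^bold>\<forall>a. a \<^bold>\<in> X \<^bold>\<longrightarrow> a \<^bold>\<in> Y)"

definition fset_eq :: "('a, 'c) name \<Rightarrow> ('a, 'c) name \<Rightarrow> 'c sentence" (infix "\<^bold>=" 50) where
  "(X \<^bold>= Y) = (\<^bold>\<forall>a. a \<^bold>\<in> X \<^bold>\<longleftrightarrow> a \<^bold>\<in> Y)"

definition check_set :: "'a set \<Rightarrow> ('a, 'c) name" where
  "check_set A = A \<times> UNIV"

text \<open>\<open>(X, S) \<in> g\<close>, where \<open>g\<close> names a set of pairs of subsets of ground model sets.\<close>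

definition fgraph ::
  "(('a, 'c) name \<times> ('b, 'c) name, 'c) name \<Rightarrow> ('a, 'c) name \<Rightarrow> ('b, 'c) name \<Rightarrow> 'c sentence"
where
  "fgraph g X S = fmem (\<lambda>(X, S) (Y, T). (X \<^bold>= Y) \<^bold>\<and> (S \<^bold>= T)) (X, S) g"


section \<open>The forcing notion\<close>

definition tuples :: "nat \<Rightarrow> nat list set" where
  "tuples k = {xs. length xs = k}"

text \<open>The value at \<open>0\<close> is irrelevant.\<close>

fun Fin_pow :: "nat \<Rightarrow> nat list set set" where
  "Fin_pow 0 = {{}}"
| "Fin_pow (Suc 0) = {X. X \<subseteq> tuples 1 \<and> finite X}"
| "Fin_pow (Suc (Suc k)) =
    {X. X \<subseteq> tuples (Suc (Suc k)) \<and> finite {i. {js. i # js \<in> X} \<notin> Fin_pow (Suc k)}}"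

text \<open>
  The forcing with the nonzero elements of the quotient algebra, given on representatives:
  conditions are the sets outside the ideal, ordered by inclusion modulo the ideal.
\<close>

definition Fin_le :: "nat \<Rightarrow> nat list set \<Rightarrow> nat list set \<Rightarrow> bool" where
  "Fin_le k A B \<longleftrightarrow>
    A \<subseteq> tuples k \<and> B \<subseteq> tuples k \<and> A \<notin> Fin_pow k \<and> A - B \<in> Fin_pow k"

type_synonym cnd = "nat list set"

text \<open>
  The canonical name of the generic ultrafilter. Its pairs whose second component is not
  a condition have no effect on \<open>fmem\<close>.
\<close>

definition generic_name :: "((nat list, cnd) name, cnd) name" where
  "generic_name = {(check_set A, A) | A. True}"

definition in_G :: "(nat list, cnd) name \<Rightarrow> cnd sentence" where
  "in_G X = fmem (\<^bold>=) X generic_name"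


section \<open>The index set of the Ellentuck space\<close>

text \<open>The objects of this section consist of hereditarily finite sets and are absolute.\<close>

definition nd_le :: "nat \<Rightarrow> nat list set" where
  "nd_le k = {j. sorted j \<and> length j \<le> k}"

definition nd :: "nat \<Rightarrow> nat list set" where
  "nd k = {j. sorted j \<and> length j = k}"

definition prec :: "nat list \<Rightarrow> nat list \<Rightarrow> bool" (infix "\<prec>" 50) where
  "j \<prec> l \<longleftrightarrow>
    (j = [] \<and> l \<noteq> []) \<or>
    (j \<noteq> [] \<and> l \<noteq> [] \<and>
      (last j < last l \<or> (last j = last l \<and> (j, l) \<in> lexord less_than)))"

definition index_in :: "nat list set \<Rightarrow> nat list \<Rightarrow> nat" where
  "index_in S l = card {j \<in> S. j \<prec> l}"

definition nth_in :: "nat list set \<Rightarrow> nat \<Rightarrow> nat list" where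
  "nth_in S m = (THE j. j \<in> S \<and> index_in S j = m)"

definition W_set :: "nat \<Rightarrow> nat list \<Rightarrow> nat set" where
  "W_set k j = {index_in (nd_le k) (take q j) | q. 1 \<le> q \<and> q \<le> length j}"

definition W_hat :: "nat \<Rightarrow> nat set set" where
  "W_hat k = W_set k ` nd_le k"

definition init_seg :: "nat set \<Rightarrow> nat set \<Rightarrow> bool" where
  "init_seg a b \<longleftrightarrow> a \<subseteq> b \<and> (\<forall>x\<in>a. \<forall>y\<in>b. y < x \<longrightarrow> y \<in> a)"


section \<open>The Ellentuck space, as defined in V[G]\<close>

text \<open>\<open>F\<close> names the graph of an \<open>\<E>\<^sub>k\<close>-tree.\<close>

definition E_tree :: "nat \<Rightarrow> (nat list \<times> nat set, 'c) name \<Rightarrow> 'c sentence" where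
  "E_tree k F =
    ((\<^bold>\<forall>j w. (j, w) \<^bold>\<in> F \<^bold>\<longrightarrow> \<langle>j \<in> nd_le k \<and> w \<in> W_hat k\<rangle>) \<^bold>\<and>
     (\<^bold>\<forall>j. \<langle>j \<in> nd_le k\<rangle> \<^bold>\<longrightarrow> (\<^bold>\<exists>w. (j, w) \<^bold>\<in> F)) \<^bold>\<and>
     (\<^bold>\<forall>j w w'. (j, w) \<^bold>\<in> F \<^bold>\<and> (j, w') \<^bold>\<in> F \<^bold>\<longrightarrow> \<langle>w = w'\<rangle>) \<^bold>\<and>
     (\<^bold>\<forall>m w. (nth_in (nd_le k) m, w) \<^bold>\<in> F \<^bold>\<longrightarrow> \<langle>card w = length (nth_in (nd_le k) m)\<rangle>) \<^bold>\<and>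
     (\<^bold>\<forall>m w w'. \<langle>1 \<le> m\<rangle> \<^bold>\<and> (nth_in (nd_le k) m, w) \<^bold>\<in> F \<^bold>\<and> (nth_in (nd_le k) (m + 1), w') \<^bold>\<in> F \<^bold>\<longrightarrow>
        \<langle>Max w < Max w'\<rangle>) \<^bold>\<and>
     (\<^bold>\<forall>m n w w'. (nth_in (nd_le k) m, w) \<^bold>\<in> F \<^bold>\<and> (nth_in (nd_le k) n, w') \<^bold>\<in> F \<^bold>\<longrightarrow>
        \<langle>(init_seg w w' \<and> w \<noteq> w') \<longleftrightarrow> strict_prefix (nth_in (nd_le k) m) (nth_in (nd_le k) n)\<rangle>))"

text \<open>
  \<open>X\<close> is the range of the restriction of the tree \<open>F\<close> to sequences of length \<open>k\<close>;
  \<open>k\<close>-element sets of naturals are turned into their increasing enumerations.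
\<close>

definition tree_range :: "nat \<Rightarrow> (nat list \<times> nat set, 'c) name \<Rightarrow> (nat list, 'c) name \<Rightarrow> 'c sentence"
where
  "tree_range k F X =
    (\<^bold>\<forall>a. a \<^bold>\<in> X \<^bold>\<longleftrightarrow> (\<^bold>\<exists>j w. \<langle>j \<in> nd k \<and> a = sorted_list_of_set w\<rangle> \<^bold>\<and> (j, w) \<^bold>\<in> F))"

definition in_E :: "nat \<Rightarrow> (nat list, 'c) name \<Rightarrow> 'c sentence" where
  "in_E k X = (\<^bold>\<exists>F. E_tree k F \<^bold>\<and> tree_range k F X)"

text \<open>
  \<open>s\<close> is the \<open>n\<close>-th approximation of the tree \<open>F\<close>. Finite approximations are hereditarily finite,
  so they are ground model sets.
\<close>

definition tree_approx :: "nat \<Rightarrow> nat \<Rightarrow> (nat list \<times> nat set, 'c) name \<Rightarrow> nat list set \<Rightarrow> 'c sentence"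
where
  "tree_approx k n F s =
    (\<^bold>\<forall>a. \<langle>a \<in> s\<rangle> \<^bold>\<longleftrightarrow>
      (\<^bold>\<exists>p w. \<langle>p < n \<and> a = sorted_list_of_set w\<rangle> \<^bold>\<and> (nth_in (nd k) p, w) \<^bold>\<in> F))"

text \<open>\<open>s = r\<^sub>n(X)\<close> for \<open>X\<close> in \<open>\<E>\<^sub>k\<close>; by clause (ii) the tree is determined by its range.\<close>

definition approx :: "nat \<Rightarrow> nat \<Rightarrow> (nat list, 'c) name \<Rightarrow> nat list set \<Rightarrow> 'c sentence" where
  "approx k n X s = (\<^bold>\<exists>F. E_tree k F \<^bold>\<and> tree_range k F X \<^bold>\<and> tree_approx k n F s)"

definition in_AR :: "nat \<Rightarrow> nat list set \<Rightarrow> 'c sentence" where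
  "in_AR k s = (\<^bold>\<exists>X :: (nat list, 'c) name. \<^bold>\<exists>n. in_E k X \<^bold>\<and> approx k n X s)"

text \<open>Proper end-extension: \<open>t = r\<^sub>n(X)\<close> has \<open>n\<close> elements, and \<open>s = r\<^sub>m(t) = r\<^sub>m(X)\<close> with \<open>m < n\<close>.\<close>

definition end_ext :: "nat \<Rightarrow> nat list set \<Rightarrow> nat list set \<Rightarrow> 'c sentence" where
  "end_ext k s t =
    (\<^bold>\<exists>X :: (nat list, 'c) name. \<^bold>\<exists>m n. in_E k X \<^bold>\<and> \<langle>m < n\<rangle> \<^bold>\<and> approx k m X s \<^bold>\<and> approx k n X t)"

definition in_AR_below :: "nat \<Rightarrow> (nat list, 'c) name \<Rightarrow> nat list set \<Rightarrow> 'c sentence" where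
  "in_AR_below k Y s = (in_AR k s \<^bold>\<and> (\<^bold>\<forall>a. \<langle>a \<in> s\<rangle> \<^bold>\<longrightarrow> a \<^bold>\<in> Y))"

text \<open>
  Every member of \<open>\<E>\<^sub>k\<close> is a subset of the range of \<open>W_set k\<close> on \<open>nd k\<close>, whose complement in
  \<open>\<omega>\<^sup>k\<close> is not in the ideal for \<open>k \<ge> 2\<close>. Hence \<open>\<B>\<^sub>k\<close> is empty for generics containing that
  complement, and it is nonempty iff the generic contains that range.
\<close>

definition in_B :: "nat \<Rightarrow> (nat list, cnd) name \<Rightarrow> cnd sentence" where
  "in_B k X = (in_G X \<^bold>\<and> in_E k X)"

definition in_B_below :: "nat \<Rightarrow> (nat list, cnd) name \<Rightarrow> (nat list, cnd) name \<Rightarrow> cnd sentence" where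
  "in_B_below k Y X = (in_B k X \<^bold>\<and> X \<^bold>\<subseteq> Y)"


section \<open>Monotone and basic functions\<close>

text \<open>A function \<open>D \<rightarrow> \<P>(\<omega>)\<close> is given by its graph \<open>R\<close>.\<close>

definition monotone_fun ::
  "((nat list, 'c) name \<Rightarrow> 'c sentence) \<Rightarrow>
   ((nat list, 'c) name \<Rightarrow> (nat, 'c) name \<Rightarrow> 'c sentence) \<Rightarrow> 'c sentence"
where
  "monotone_fun D R =
    ((\<^bold>\<forall>X S. R X S \<^bold>\<longrightarrow> D X) \<^bold>\<and>
     (\<^bold>\<forall>X. D X \<^bold>\<longrightarrow> (\<^bold>\<exists>S. R X S)) \<^bold>\<and>
     (\<^bold>\<forall>X S T. R X S \<^bold>\<and> R X T \<^bold>\<longrightarrow> S \<^bold>= T) \<^bold>\<and>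
     (\<^bold>\<forall>X Y S T. R X S \<^bold>\<and> R Y T \<^bold>\<and> X \<^bold>\<subseteq> Y \<^bold>\<longrightarrow> S \<^bold>\<subseteq> T))"

definition restrict_graph ::
  "('x \<Rightarrow> 'c sentence) \<Rightarrow> ('x \<Rightarrow> 'y \<Rightarrow> 'c sentence) \<Rightarrow> 'x \<Rightarrow> 'y \<Rightarrow> 'c sentence"
where
  "restrict_graph D R X S = (D X \<^bold>\<and> R X S)"

definition basic ::
  "nat \<Rightarrow> (nat list, cnd) name \<Rightarrow>
   ((nat list, cnd) name \<Rightarrow> (nat, cnd) name \<Rightarrow> cnd sentence) \<Rightarrow> cnd sentence"
where
  "basic k Y R =
    (monotone_fun (in_B_below k Y) R \<^bold>\<and>
     (\<^bold>\<exists>h :: (nat list set \<times> nat set, cnd) name.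
       (\<^bold>\<forall>s u. (s, u) \<^bold>\<in> h \<^bold>\<longrightarrow> in_AR_below k Y s \<^bold>\<and> \<langle>finite u\<rangle>) \<^bold>\<and>
       (\<^bold>\<forall>s. in_AR_below k Y s \<^bold>\<longrightarrow> (\<^bold>\<exists>u. (s, u) \<^bold>\<in> h)) \<^bold>\<and>
       (\<^bold>\<forall>s u v. (s, u) \<^bold>\<in> h \<^bold>\<and> (s, v) \<^bold>\<in> h \<^bold>\<longrightarrow> \<langle>u = v\<rangle>) \<^bold>\<and>
       (\<^bold>\<forall>s t u v. (s, u) \<^bold>\<in> h \<^bold>\<and> (t, v) \<^bold>\<in> h \<^bold>\<and> \<langle>s \<subseteq> t\<rangle> \<^bold>\<longrightarrow> \<langle>u \<subseteq> v\<rangle>) \<^bold>\<and>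
       (\<^bold>\<forall>s t u v. (s, u) \<^bold>\<in> h \<^bold>\<and> (t, v) \<^bold>\<in> h \<^bold>\<and> end_ext k s t \<^bold>\<longrightarrow> \<langle>init_seg u v\<rangle>) \<^bold>\<and>
       (\<^bold>\<forall>X S. R X S \<^bold>\<longrightarrow>
         (\<^bold>\<forall>i. i \<^bold>\<in> S \<^bold>\<longleftrightarrow>
           (\<^bold>\<exists>n s u. approx k n X s \<^bold>\<and> (s, u) \<^bold>\<in> h \<^bold>\<and> \<langle>i \<in> u\<rangle>)))))"

end

theory Submission
  imports Defs "HOL-Library.Infinite_Set"
begin

text \<open>
  Call a set of \<open>k\<close>-tuples positive if it is a condition. For a finite set \<open>s\<close> of tuples let
  \<open>Y\<^sub>s\<close> consist of \<open>s\<close> and of those \<open>v \<in> Y\<close> that branch off from \<open>s\<close> with an entry larger than all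
  entries of \<open>s\<close>; every \<open>V \<le> Y\<close> in \<open>\<E>\<^sub>k\<close> with approximation \<open>s\<close> satisfies \<open>V \<subseteq> Y\<^sub>s\<close>.
  Say that \<open>C\<close> omits \<open>i\<close> if \<open>C\<close> forces \<open>i \<notin> g(C)\<close>; by monotonicity this passes to positive subsets.

  A fusion yields \<open>Y \<in> \<E>\<^sub>k\<close> such that for all finite \<open>s \<subseteq> Y\<close> and all \<open>i \<le> max s\<close>, if some
  \<open>C \<subseteq> Y\<^sub>s\<close> containing \<open>s\<close> and positive above every node of \<open>s\<close> omits \<open>i\<close>, then so does \<open>Y\<^sub>s\<close>.
  A fusion step replaces the part of the current set that branches off from \<open>s\<close> by such a \<open>C\<close>, which
  leaves the set positive above the other nodes built so far. Then \<open>Y\<close> forces that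
  \<open>s \<mapsto> {i \<le> max s. Y\<^sub>s does not omit i}\<close> witnesses that \<open>g\<close> is basic: if \<open>V \<le> Y\<close> has approximation
  \<open>s\<close> and some \<open>r \<le> V\<close> forces \<open>i \<notin> g(V)\<close>, then adding to \<open>r \<inter> V\<close> the finitely many columns of \<open>V\<close>
  that start continuation \<open>max s\<close> gives an equivalent condition \<open>C\<close> as above.

  The forcing is \<open>\<sigma>\<close>-closed, so members of \<open>\<E>\<^sub>k\<close> in the extension lie in the ground model.
\<close>


section \<open>The well-order of the nodes\<close>

lemma prec_irrefl: "\<not> j \<prec> j"
  by (auto simp: prec_def lexord_irreflexive)

lemma prec_trans: "i \<prec> j \<Longrightarrow> j \<prec> l \<Longrightarrow> i \<prec> l"
  unfolding prec_def
  using lexord_trans[OF _ _ trans_less_than] by fastforce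

lemma prec_linear: "i \<prec> j \<or> i = j \<or> j \<prec> i"
proof -
  have "(i, j) \<in> lexord less_than \<or> i = j \<or> (j, i) \<in> lexord less_than"
    by (rule lexord_linear) auto
  then show ?thesis unfolding prec_def by (cases "i = []"; cases "j = []") auto
qed

text \<open>A non-decreasing list is bounded by its last entry, and a predecessor of
  \<open>l\<close> has last entry at most \<open>last l\<close>, so only finitely many lists of
  length at most \<open>k\<close> qualify. Thus \<open>index_in\<close>, a cardinality, is a genuine
  rank.\<close>

lemma finite_prec:
  assumes "S \<subseteq> nd_le k"
  shows "finite {j \<in> S. j \<prec> l}"
proof (rule finite_subset)
  show "{j \<in> S. j \<prec> l} \<subseteq> {j. set j \<subseteq> {..last l} \<and> length j \<le> k}"
  proof safe
    fix j x assume j: "j \<in> S" "j \<prec> l" and x: "x \<in> set j"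
    then have "sorted j" "j \<noteq> []" using assms by (auto simp: nd_le_def)
    then have "x \<le> last j" using x
      by (cases j rule: rev_cases) (auto simp: sorted_append)
    also have "last j \<le> last l" using j \<open>j \<noteq> []\<close> by (auto simp: prec_def)
    finally show "x \<le> last l" .
  next
    fix j assume "j \<in> S" then show "length j \<le> k" using assms by (auto simp: nd_le_def)
  qed
qed (simp add: finite_lists_length_le)

lemma index_in_mono:
  assumes "S \<subseteq> nd_le k" "i \<in> S" "i \<prec> j"
  shows "index_in S i < index_in S j"
  unfolding index_in_def
proof (rule psubset_card_mono[OF finite_prec[OF assms(1)]])
  show "{j \<in> S. j \<prec> i} \<subset> {ja \<in> S. ja \<prec> j}"
    using assms prec_trans prec_irrefl by blast
qed

lemma index_in_less_iff:
  assumes "S \<subseteq> nd_le k" "i \<in> S" "j \<in> S"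
  shows "index_in S i < index_in S j \<longleftrightarrow> i \<prec> j"
  using assms by (metis index_in_mono less_asym less_irrefl prec_linear)

lemma index_in_inj: "S \<subseteq> nd_le k \<Longrightarrow> inj_on (index_in S) S"
  by (metis index_in_mono inj_onI less_irrefl prec_linear)

text \<open>Injectivity on an infinite set gives a node of index above \<open>m\<close>. The indices
  of its predecessors are distinct and smaller than its own, and there are exactly as many of them
  as smaller numbers, so \<open>m\<close> is among them.\<close>

lemma index_in_surj:
  assumes S: "S \<subseteq> nd_le k" "infinite S"
  shows "\<exists>j\<in>S. index_in S j = m"
proof -
  have "infinite (index_in S ` S)" using S index_in_inj finite_imageD by blast
  then obtain j where j: "j \<in> S" "m < index_in S j"
    by (metis (no_types, lifting) imageE infinite_nat_iff_unbounded)
  let ?P = "{i \<in> S. i \<prec> j}"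
  have "index_in S ` ?P = {..<index_in S j}"
  proof (rule card_subset_eq)
    show "index_in S ` ?P \<subseteq> {..<index_in S j}" using index_in_mono S(1) by auto
    have "inj_on (index_in S) ?P" using index_in_inj[OF S(1)] by (rule inj_on_subset) auto
    then show "card (index_in S ` ?P) = card {..<index_in S j}"
      by (simp add: card_image) (simp add: index_in_def)
  qed simp
  then show ?thesis using j by (metis (no_types, lifting) imageE lessThan_iff mem_Collect_eq)
qed

lemma nth_in:
  assumes S: "S \<subseteq> nd_le k" "infinite S"
  shows nth_in_mem: "nth_in S m \<in> S" and index_nth_in: "index_in S (nth_in S m) = m"
proof -
  have "\<exists>!j. j \<in> S \<and> index_in S j = m"
    using index_in_surj[OF S] index_in_inj[OF S(1)] by (metis inj_onD)
  from theI'[OF this] show "nth_in S m \<in> S" "index_in S (nth_in S m) = m"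
    unfolding nth_in_def by auto
qed

lemma nth_in_index:
  assumes S: "S \<subseteq> nd_le k" "infinite S" and "j \<in> S"
  shows "nth_in S (index_in S j) = j"
  using nth_in[OF S] index_in_inj[OF S(1)] assms(3) by (metis inj_onD)

lemma nth_in_prec_iff:
  assumes S: "S \<subseteq> nd_le k" "infinite S"
  shows "nth_in S m \<prec> nth_in S n \<longleftrightarrow> m < n"
  using index_in_less_iff[OF S(1)] nth_in[OF S] by metis

lemma nd_subset: "nd k \<subseteq> nd_le k"
  by (auto simp: nd_def nd_le_def)

lemma infinite_nd:
  assumes "1 \<le> k" shows "infinite (nd k)"
proof
  assume fin: "finite (nd k)"
  have "range (replicate k) \<subseteq> nd k" by (auto simp: nd_def)
  moreover have "inj (replicate k)" using assms by (auto simp: inj_def)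
  ultimately show False using fin finite_subset finite_imageD
    by (metis infinite_UNIV_nat)
qed

lemma infinite_nd_le: "1 \<le> k \<Longrightarrow> infinite (nd_le k)"
  using infinite_nd nd_subset finite_subset by blast

lemma take_nd_le: "j \<in> nd_le k \<Longrightarrow> take q j \<in> nd_le k"
  by (auto simp: nd_le_def sorted_wrt_take)

text \<open>Extending a non-decreasing list cannot lower its last entry, and a tie is broken
  lexicographically in favour of the initial segment.\<close>

lemma prec_strict_prefix:
  assumes "sorted l" "strict_prefix j l"
  shows "j \<prec> l"
proof -
  obtain u where u: "l = j @ u" "u \<noteq> []" using assms(2) by (auto simp: strict_prefix_def prefix_def)
  show ?thesis
  proof (cases "j = []")
    case False
    have "last j \<le> last l" using assms(1) u False by (auto simp: sorted_append)
    moreover have "(j, l) \<in> lexord less_than"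
      using u by (cases u) (auto simp: lexord_def)
    ultimately show ?thesis using False u unfolding prec_def by auto
  qed (use u in \<open>auto simp: prec_def\<close>)
qed

lemma nth_in_nd_le_0: "1 \<le> k \<Longrightarrow> nth_in (nd_le k) 0 = []"
proof -
  assume k: "1 \<le> k"
  have "index_in (nd_le k) [] = 0" by (auto simp: index_in_def prec_def)
  moreover have "[] \<in> nd_le k" by (simp add: nd_le_def)
  ultimately show ?thesis using nth_in_index[OF _ infinite_nd_le[OF k]] by (metis order_refl)
qed

lemma infinite_successors:
  "j \<in> nd_le k \<Longrightarrow> length j < k \<Longrightarrow> infinite {x. j @ [x] \<in> nd_le k}"
proof -
  assume j: "j \<in> nd_le k" "length j < k"
  have "{Max (insert 0 (set j))..} \<subseteq> {x. j @ [x] \<in> nd_le k}"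
    using j by (auto simp: nd_le_def sorted_append)
  then show ?thesis using infinite_Ici finite_subset by blast
qed


section \<open>Positive sets\<close>

text \<open>The value at \<open>0\<close> lets the recursion on columns run down to single tuples.\<close>

fun positive :: "nat \<Rightarrow> nat list set \<Rightarrow> bool" where
  "positive 0 X \<longleftrightarrow> [] \<in> X"
| "positive (Suc k) X \<longleftrightarrow> infinite {i. positive k {js. i # js \<in> X}}"

lemma positive_mono: "positive k X \<Longrightarrow> X \<subseteq> Y \<Longrightarrow> positive k Y"
proof (induction k arbitrary: X Y)
  case (Suc k)
  have "{i. positive k {js. i # js \<in> X}} \<subseteq> {i. positive k {js. i # js \<in> Y}}"
  proof safe
    fix i assume "positive k {js. i # js \<in> X}"
    then show "positive k {js. i # js \<in> Y}" by (rule Suc.IH) (use Suc.prems(2) in auto)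
  qed
  from finite_subset[OF this] show ?case using Suc.prems(1) by auto
qed auto

text \<open>The sets that are not positive form an ideal: an infinite set of columns cannot be the
  union of two finite ones, and each column is split by induction.\<close>

lemma positive_Un: "positive k (X \<union> Y) \<Longrightarrow> positive k X \<or> positive k Y"
proof (induction k arbitrary: X Y)
  case (Suc k)
  have "{i. positive k {js. i # js \<in> X \<union> Y}} \<subseteq> {i. positive k {js. i # js \<in> X}} \<union> {i. positive k {js. i # js \<in> Y}}"
  proof
    fix i assume "i \<in> {i. positive k {js. i # js \<in> X \<union> Y}}"
    then have "positive k ({js. i # js \<in> X} \<union> {js. i # js \<in> Y})" by (simp add: Collect_disj_eq)
    then show "i \<in> {i. positive k {js. i # js \<in> X}} \<union> {i. positive k {js. i # js \<in> Y}}"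
      by (auto dest: Suc.IH)
  qed
  from finite_subset[OF this] show ?case using Suc.prems by auto
qed auto

lemma positive_nonempty: "positive k X \<Longrightarrow> \<exists>u\<in>X. length u = k"
proof (induction k arbitrary: X)
  case (Suc k)
  then obtain i where "positive k {js. i # js \<in> X}"
    using not_finite_existsD[of "\<lambda>i. positive k {js. i # js \<in> X}"] by auto
  from Suc.IH[OF this] show ?case by force
qed auto

text \<open>At \<open>k = 1\<close> a set of one-element lists is in bijection with its set of
  entries; above that both recursions speak of the same columns.\<close>

lemma positive_iff_Fin_pow: "1 \<le> k \<Longrightarrow> X \<subseteq> tuples k \<Longrightarrow> X \<notin> Fin_pow k \<longleftrightarrow> positive k X"
proof (induction k arbitrary: X rule: Fin_pow.induct)
  case 2
  have "X = (\<lambda>i. [i]) ` {i. [i] \<in> X}"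
    using 2 by (auto simp: tuples_def length_Suc_conv)
  then have "finite X \<longleftrightarrow> finite {i. [i] \<in> X}"
    using finite_image_iff[of "\<lambda>i. [i]" "{i. [i] \<in> X}"] by (simp add: inj_on_def)
  then show ?case using 2 by simp
next
  case (3 k)
  have "{js. i # js \<in> X} \<subseteq> tuples (Suc k)" for i
    using 3(3) by (auto simp: tuples_def)
  then show ?case using 3 by simp
qed auto

section \<open>The order of the forcing and its countable closure\<close>

lemma Fin_le_iff:
  assumes "1 \<le> k"
  shows "Fin_le k A B \<longleftrightarrow> A \<subseteq> tuples k \<and> B \<subseteq> tuples k \<and> positive k A \<and> \<not> positive k (A - B)"
  unfolding Fin_le_def using positive_iff_Fin_pow[OF assms, of A] positive_iff_Fin_pow[OF assms, of "A - B"]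
  by blast

text \<open>Conditions are the reflexive points of the order, so both sides of a related pair have
  to be conditions. The larger one is positive because \<open>A\<close> is covered by the negligible
  \<open>A - B\<close> together with \<open>B\<close>.\<close>

lemma
  assumes AB: "Fin_le k A B" and k: "1 \<le> k"
  shows Fin_le_refl1: "Fin_le k A A" and Fin_le_refl2: "Fin_le k B B"
proof -
  have e: "\<not> positive k {}" using positive_nonempty[of k "{}"] by auto
  have "positive k A" using AB by (simp add: Fin_le_iff[OF k])
  then have "positive k (A - B \<union> B)" by (rule positive_mono) auto
  then have "positive k B" using AB positive_Un[of k "A - B" B] by (simp add: Fin_le_iff[OF k])
  then show "Fin_le k A A" "Fin_le k B B"
    using AB e by (simp_all add: Fin_le_iff[OF k])
qed

lemma Fin_le_trans:
  assumes k: "1 \<le> k" and AB: "Fin_le k A B" and BC: "Fin_le k B C"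
  shows "Fin_le k A C"
proof -
  have "\<not> positive k (A - C)"
  proof
    assume "positive k (A - C)"
    then have "positive k (A - B \<union> (B - C))" by (rule positive_mono) auto
    then show False using positive_Un AB BC by (simp add: Fin_le_iff[OF k]) blast
  qed
  then show ?thesis using AB BC by (simp add: Fin_le_iff[OF k])
qed

lemma Fin_le_subset:
  assumes "1 \<le> k" "positive k A" "A \<subseteq> B" "B \<subseteq> tuples k"
  shows "Fin_le k A B"
proof -
  have "A - B = {}" using assms by auto
  then show ?thesis using assms positive_nonempty[of k "A - B"] by (simp add: Fin_le_iff) blast
qed

lemma Fin_le_positive_Int:
  assumes "1 \<le> k" "Fin_le k A B"
  shows "positive k (A \<inter> B)"
proof -
  have "(A - B) \<union> (A \<inter> B) = A" by auto
  then have "positive k ((A - B) \<union> (A \<inter> B))" using assms by (simp add: Fin_le_iff)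
  then show ?thesis using positive_Un[of k "A - B" "A \<inter> B"] assms by (simp add: Fin_le_iff)
qed

text \<open>Only the columns up to \<open>b\<close> can be nonempty. This is the way in which
  finitely many columns are seen to be negligible.\<close>

lemma not_positive_first_bounded:
  assumes "1 \<le> k" "\<And>v. v \<in> X \<Longrightarrow> v \<noteq> [] \<Longrightarrow> hd v \<le> b"
  shows "\<not> positive k X"
proof -
  obtain k' where k: "k = Suc k'" using assms(1) by (cases k) auto
  have "{i. positive k' {js. i # js \<in> X}} \<subseteq> {..b}"
  proof
    fix i assume "i \<in> {i. positive k' {js. i # js \<in> X}}"
    then obtain u where "i # u \<in> X" using positive_nonempty[of k' "{js. i # js \<in> X}"] by auto
    then show "i \<in> {..b}" using assms(2)[of "i # u"] by auto
  qed
  from finite_subset[OF this] show ?thesis using k by auto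
qed

text \<open>A diagonal intersection. The finite intersections \<open>D n\<close> stay positive, so
  increasing first coordinates \<open>c n\<close> can be chosen with a positive column in
  \<open>D n\<close>. The union of these columns has infinitely many positive columns, and all but
  finitely many of them lie inside any given \<open>A n\<close>.\<close>

lemma Fin_le_sigma_closed:
  assumes k: "1 \<le> k" and dec: "\<And>n. Fin_le k (A (Suc n)) (A n)"
  shows "\<exists>B. \<forall>n. Fin_le k B (A n)"
proof -
  obtain k' where k': "k = Suc k'" using k by (cases k) auto
  have sub: "A n \<subseteq> tuples k" for n using dec[of n] by (auto simp: Fin_le_iff[OF k])
  define D where "D n = (\<Inter>m\<le>n. A m)" for n
  have le: "m \<le> n \<Longrightarrow> Fin_le k (A n) (A m)" for m n
  proof (induction n)
    case 0 then show ?case using Fin_le_refl2[OF dec[of 0] k] by simp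
  next
    case (Suc n)
    show ?case
    proof (cases "m = Suc n")
      case True
      then show ?thesis using Fin_le_refl1[OF dec[of n] k] by simp
    next
      case False
      then show ?thesis using Suc Fin_le_trans[OF k dec[of n]] by simp
    qed
  qed
  have D_positive: "positive k (D n)" for n
  proof -
    \<comment> \<open>Starting from \<open>A n\<close>, the sets \<open>A (Suc i)\<close> are
      intersected in one at a time; each removes only part of the negligible set
      \<open>A n - A (Suc i)\<close>.\<close>
    have *: "positive k (\<Inter>m\<le>i. A n \<inter> A m)" if "i \<le> n" for i
      using that
    proof (induction i)
      case 0 then show ?case using Fin_le_positive_Int[OF k le[of 0 n]] by simp
    next
      case (Suc i)
      let ?P = "\<Inter>m\<le>i. A n \<inter> A m"
      have "positive k (?P - (A n - A (Suc i)) \<union> (A n - A (Suc i)))"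
        by (rule positive_mono[of k ?P]) (use Suc in auto)
      moreover have "\<not> positive k (A n - A (Suc i))"
        using le[of "Suc i" n] Suc.prems by (simp add: Fin_le_iff[OF k])
      ultimately have "positive k (?P - (A n - A (Suc i)))"
        using positive_Un[of k "?P - (A n - A (Suc i))" "A n - A (Suc i)"] by metis
      then show ?case by (rule positive_mono) (auto simp: le_Suc_eq)
    qed
    show ?thesis using *[of n] by (rule positive_mono) (auto simp: D_def)
  qed
  have "\<exists>c. \<forall>n. positive k' {js. c n # js \<in> D n} \<and> c n < c (Suc n)"
  proof (rule dependent_nat_choice)
    show "\<exists>i. positive k' {js. i # js \<in> D 0}"
      using D_positive[of 0] not_finite_existsD[of "\<lambda>i. positive k' {js. i # js \<in> D 0}"] unfolding k' by simp
    fix x n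
    have "infinite {i. positive k' {js. i # js \<in> D (Suc n)}}" using D_positive[of "Suc n"] k' by simp
    then show "\<exists>y. positive k' {js. y # js \<in> D (Suc n)} \<and> x < y"
      unfolding infinite_nat_iff_unbounded by blast
  qed
  then obtain c where c: "\<And>n. positive k' {js. c n # js \<in> D n}" "\<And>n. c n < c (Suc n)" by blast
  then have mono: "strict_mono c" by (simp add: strict_mono_Suc_iff)
  \<comment> \<open>\<open>B\<close> takes one column from each \<open>D n\<close>; those taken before stage \<open>n\<close> are negligible\<close>
  define B where "B = {c n # js | n js. c n # js \<in> D n}"
  have "positive k B"
  proof -
    have "range c \<subseteq> {i. positive k' {js. i # js \<in> B}}"
    proof safe
      fix n show "positive k' {js. c n # js \<in> B}"
        by (rule positive_mono[OF c(1)[of n]]) (auto simp: B_def)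
    qed
    moreover have "infinite (range c)"
      using mono by (simp add: finite_image_iff strict_mono_imp_inj_on)
    ultimately show ?thesis using k' finite_subset[of "range c"] by auto
  qed
  moreover have "\<not> positive k (B - A n)" for n
  proof (rule not_positive_first_bounded[OF k])
    fix v assume "v \<in> B - A n"
    then obtain m js where m: "v = c m # js" "v \<in> D m" "v \<notin> A n" by (auto simp: B_def)
    then have "m < n" by (intro not_le_imp_less) (auto simp: D_def)
    then show "hd v \<le> c n" using m mono by (simp add: strict_mono_less less_imp_le)
  qed
  moreover have "B \<subseteq> tuples k" using sub[of 0] by (auto simp: B_def D_def)
  ultimately show ?thesis using sub by (auto simp: Fin_le_iff[OF k])
qed

text \<open>A descending sequence enters the open dense sets one after the other, and a lower bound
  of it lies in all of them. This is how countably many values of a name are decided at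
  once.\<close>

lemma Fin_le_distributive:
  assumes k: "1 \<le> k" and p: "Fin_le k p p"
    and dense: "\<And>(n::nat) q. Fin_le k q p \<Longrightarrow> \<exists>r. Fin_le k r q \<and> D n r"
    and "open": "\<And>n q r. D n q \<Longrightarrow> Fin_le k r q \<Longrightarrow> D n r"
  shows "\<exists>r. Fin_le k r p \<and> (\<forall>n. D n r)"
proof -
  have "\<exists>A. \<forall>n. (Fin_le k (A n) p) \<and> (Fin_le k (A (Suc n)) (A n) \<and> D n (A (Suc n)))"
  proof (rule dependent_nat_choice)
    show "\<exists>x. Fin_le k x p" using p by blast
    fix x n assume "Fin_le k x p"
    then show "\<exists>y. Fin_le k y p \<and> Fin_le k y x \<and> D n y"
      using dense[of x n] Fin_le_trans[OF k] by blast
  qed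
  then obtain A where A: "\<And>n. Fin_le k (A n) p" "\<And>n. Fin_le k (A (Suc n)) (A n)"
    "\<And>n. D n (A (Suc n))" by auto
  then obtain B where B: "\<And>n. Fin_le k B (A n)" using Fin_le_sigma_closed[OF k, of A] by blast
  have "Fin_le k B p" using Fin_le_trans[OF k B A(1)] .
  moreover have "D n B" for n using "open"[OF A(3) B] .
  ultimately show ?thesis by blast
qed


section \<open>Trees of increasing lists\<close>

definition fiber :: "nat list set \<Rightarrow> nat list \<Rightarrow> nat list set" where
  "fiber X t = {u. t @ u \<in> X}"

definition entries :: "nat list set \<Rightarrow> nat set" where
  "entries s = \<Union> (set ` s)"

text \<open>
  A member of \<open>\<E>\<^sub>k\<close> with approximation \<open>s\<close> consists of \<open>s\<close> and of elements of \<open>branching s\<close>.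
\<close>

definition branching :: "nat list set \<Rightarrow> nat list set" where
  "branching s = {v. \<exists>q<length v. (q = 0 \<or> (\<exists>u\<in>s. take q u = take q v)) \<and> (\<forall>x\<in>entries s. x < v ! q)}"

definition continuation :: "nat list set \<Rightarrow> nat list set \<Rightarrow> nat list set" where
  "continuation Y s = s \<union> (Y \<inter> branching s)"

text \<open>The case \<open>q = k\<close> is included on purpose: for \<open>k\<close>-tuples
  \<open>positive 0\<close> of the fiber says that the element of \<open>s\<close> itself lies in
  \<open>C\<close>.\<close>

definition full_over :: "nat \<Rightarrow> nat list set \<Rightarrow> nat list set \<Rightarrow> bool" where
  "full_over k C s \<longleftrightarrow> positive k C \<and> (\<forall>u\<in>s. \<forall>q\<le>k. positive (k - q) (fiber C (take q u)))"

text \<open>\<open>\<E>\<^sub>k\<close>-trees whose values are written as increasing lists.\<close>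

definition list_tree :: "nat \<Rightarrow> (nat list \<Rightarrow> nat list) \<Rightarrow> bool" where
  "list_tree k F \<longleftrightarrow>
    (\<forall>j\<in>nd_le k. length (F j) = length j \<and> sorted_wrt (<) (F j)) \<and>
    (\<forall>j\<in>nd_le k. \<forall>q. F (take q j) = take q (F j)) \<and>
    (\<forall>i\<in>nd_le k. \<forall>j\<in>nd_le k. i \<noteq> [] \<longrightarrow> i \<prec> j \<longrightarrow> last (F i) < last (F j))"

definition list_approx :: "nat \<Rightarrow> (nat list \<Rightarrow> nat list) \<Rightarrow> nat \<Rightarrow> nat list set" where
  "list_approx k F n = F ` {j \<in> nd k. index_in (nd k) j < n}"

lemma fiber_fiber_Cons: "{js. i # js \<in> fiber X t} = fiber X (t @ [i])"
  by (simp add: fiber_def)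

lemma fiber_Nil [simp]: "fiber X [] = X"
  by (simp add: fiber_def)

lemma fiber_mono: "X \<subseteq> Y \<Longrightarrow> fiber X t \<subseteq> fiber Y t"
  by (auto simp: fiber_def)

lemma positive_fiber_0: "positive 0 (fiber X t) \<longleftrightarrow> t \<in> X"
  by (simp add: fiber_def)

text \<open>Discarding the finitely many columns up to \<open>b\<close> leaves infinitely many
  positive ones.\<close>

lemma positive_tail:
  assumes "positive (Suc k) X"
  shows "positive (Suc k) {u \<in> X. u \<noteq> [] \<and> b < hd u}"
proof -
  let ?Y = "{u \<in> X. u \<noteq> [] \<and> b < hd u}"
  have "{i. positive k {js. i # js \<in> X}} \<subseteq> {..b} \<union> {i. positive k {js. i # js \<in> ?Y}}" by auto
  from finite_subset[OF this] show ?thesis using assms by auto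
qed

lemma list_tree_length: "list_tree k F \<Longrightarrow> j \<in> nd_le k \<Longrightarrow> length (F j) = length j"
  by (simp add: list_tree_def)

lemma list_tree_sorted: "list_tree k F \<Longrightarrow> j \<in> nd_le k \<Longrightarrow> sorted_wrt (<) (F j)"
  by (simp add: list_tree_def)

lemma list_tree_take: "list_tree k F \<Longrightarrow> j \<in> nd_le k \<Longrightarrow> F (take q j) = take q (F j)"
  by (simp add: list_tree_def)

lemma list_tree_last:
  "list_tree k F \<Longrightarrow> i \<in> nd_le k \<Longrightarrow> j \<in> nd_le k \<Longrightarrow> i \<noteq> [] \<Longrightarrow> i \<prec> j \<Longrightarrow> last (F i) < last (F j)"
  by (simp add: list_tree_def)

lemma list_tree_range_tuples: "list_tree k F \<Longrightarrow> F ` nd k \<subseteq> tuples k"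
  using nd_subset by (force simp: tuples_def list_tree_def nd_def)

lemma strict_sorted_le_last: "sorted_wrt (<) v \<Longrightarrow> x \<in> set v \<Longrightarrow> x \<le> last (v :: nat list)"
  by (cases v rule: rev_cases) (auto simp: sorted_wrt_append less_imp_le)

lemma list_tree_inj:
  assumes "list_tree k F" shows "inj_on F (nd k)"
proof (cases "k = 0")
  case True then show ?thesis by (auto simp: inj_on_def nd_def)
next
  case False
  show ?thesis
  proof (rule inj_onI)
    fix i j assume ij: "i \<in> nd k" "j \<in> nd k" "F i = F j"
    then have "i \<noteq> []" "j \<noteq> []" using False by (auto simp: nd_def)
    then show "i = j"
      using ij prec_linear[of i j] list_tree_last[OF assms, of i j] list_tree_last[OF assms, of j i] nd_subset[of k]
      by auto
  qed
qed

text \<open>Induction on the number of levels left. A node has infinitely many successors, their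
  values end in distinct entries, and the fiber above each successor is positive by
  induction.\<close>

lemma list_tree_positive:
  assumes F: "list_tree k F" and j: "j \<in> nd_le k"
  shows "positive (k - length j) (fiber (F ` nd k) (F j))"
  using j
proof (induction "k - length j" arbitrary: j)
  case 0
  then have "j \<in> nd k" by (simp add: nd_le_def nd_def)
  then show ?case using 0 by (simp add: positive_fiber_0 fiber_def flip: 0(1))
next
  case (Suc d)
  let ?R = "F ` nd k" and ?X = "{x. j @ [x] \<in> nd_le k}"
  let ?c = "\<lambda>x. last (F (j @ [x]))"
  \<comment> \<open>Siblings are ordered by their last entries, and a tree maps later nodes to
    larger last entries.\<close>
  have inj: "inj_on ?c ?X"
  proof -
    have "?c x < ?c y" if "x \<in> ?X" "y \<in> ?X" "x < y" for x y
    proof (rule list_tree_last[OF F])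
      show "j @ [x] \<prec> j @ [y]" using that by (auto simp: prec_def)
    qed (use that in auto)
    then show ?thesis unfolding inj_on_def by (metis (no_types, lifting) nat_neq_iff)
  qed
  have "?c ` ?X \<subseteq> {i. positive d {js. i # js \<in> fiber ?R (F j)}}"
  proof safe
    fix x assume x: "j @ [x] \<in> nd_le k"
    have "take (length j) (F (j @ [x])) = F j" using list_tree_take[OF F x, of "length j"] by simp
    moreover have len: "length (F (j @ [x])) = Suc (length j)" using list_tree_length[OF F x] by simp
    ultimately have e: "F (j @ [x]) = F j @ [?c x]"
      by (cases "F (j @ [x])" rule: rev_cases) auto
    have "positive (k - length (j @ [x])) (fiber ?R (F (j @ [x])))"
      by (rule Suc.hyps(1)) (use Suc.hyps(2) x in auto)
    moreover have "k - length (j @ [x]) = d" using Suc.hyps(2) by simp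
    ultimately show "positive d {js. ?c x # js \<in> fiber ?R (F j)}"
      unfolding fiber_fiber_Cons using e by simp
  qed
  moreover have "infinite ?X" by (rule infinite_successors[OF Suc.prems]) (use Suc.hyps(2) in simp)
  ultimately have "infinite {i. positive d {js. i # js \<in> fiber ?R (F j)}}"
    using inj finite_imageD finite_subset by blast
  then show ?case unfolding Suc.hyps(2)[symmetric] by simp
qed

lemma list_tree_range_positive:
  assumes "list_tree k F" shows "positive k (F ` nd k)"
proof -
  have "[] \<in> nd_le k" by (simp add: nd_le_def)
  moreover from this have "F [] = []" using list_tree_length[OF assms] by fastforce
  ultimately show ?thesis using list_tree_positive[OF assms, of "[]"] by simp
qed

text \<open>Above a node of \<open>s\<close>, or at the root, \<open>C\<close> contains every member
  of the tree whose next entry exceeds \<open>b\<close>. Only finitely many columns are lost there,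
  so positivity is inherited from the tree.\<close>

lemma full_overI:
  assumes F: "list_tree k F" and "1 \<le> k" and sC: "s \<subseteq> C" and s: "s \<subseteq> F ` nd k"
    and C: "\<And>v q. v \<in> F ` nd k \<Longrightarrow> q < k \<Longrightarrow> q = 0 \<or> (\<exists>u\<in>s. take q u = take q v)
      \<Longrightarrow> b < v ! q \<Longrightarrow> v \<in> C"
  shows "full_over k C s"
proof -
  have *: "positive (k - q) (fiber C t)"
    if q: "q < k" "length t = q" "q = 0 \<or> (\<exists>u\<in>s. take q u = t)" "positive (k - q) (fiber (F ` nd k) t)" for q t
  proof -
    obtain d where d: "k - q = Suc d" using q(1) by (metis Suc_diff_Suc)
    have "positive (Suc d) {u \<in> fiber (F ` nd k) t. u \<noteq> [] \<and> b < hd u}"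
      using positive_tail q(4) unfolding d by blast
    moreover have "{u \<in> fiber (F ` nd k) t. u \<noteq> [] \<and> b < hd u} \<subseteq> fiber C t"
    proof safe
      fix w assume w: "w \<in> fiber (F ` nd k) t" "w \<noteq> []" "b < hd w"
      have "t @ w \<in> C"
      proof (rule C)
        show "t @ w \<in> F ` nd k" using w by (simp add: fiber_def)
        show "q < k" by fact
        show "q = 0 \<or> (\<exists>u\<in>s. take q u = take q (t @ w))" using q by auto
        show "b < (t @ w) ! q" using w q(2) by (simp add: nth_append hd_conv_nth)
      qed
      then show "w \<in> fiber C t" by (simp add: fiber_def)
    qed
    ultimately show ?thesis unfolding d by (rule positive_mono)
  qed
  have "positive k C" using *[of 0 "[]"] list_tree_range_positive[OF F] assms(2) by simp
  moreover have "positive (k - q) (fiber C (take q u))" if u: "u \<in> s" "q \<le> k" for u q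
  proof (cases "q = k")
    case True
    have "take k u = u" using u(1) s list_tree_range_tuples[OF F] by (auto simp: tuples_def)
    then show ?thesis using True u sC by (auto simp: fiber_def)
  next
    case False
    obtain j where j: "j \<in> nd k" "u = F j" using u s by auto
    then have jn: "j \<in> nd_le k" "length j = k" using nd_subset by (auto simp: nd_def)
    have "positive (k - length (take q j)) (fiber (F ` nd k) (F (take q j)))"
      by (rule list_tree_positive[OF F take_nd_le[OF jn(1)]])
    then have "positive (k - q) (fiber (F ` nd k) (take q u))"
      using jn j list_tree_take[OF F jn(1)] u(2) by (simp add: min.absorb2)
    then show ?thesis
      using *[of q "take q u"] False u j jn list_tree_length[OF F jn(1)] by auto
  qed
  ultimately show ?thesis by (simp add: full_over_def)
qed

section \<open>Finite approximations and how a tree branches off from them\<close>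

lemma list_approx_subset: "list_approx k F n \<subseteq> F ` nd k"
  by (auto simp: list_approx_def)

lemma finite_list_approx:
  assumes "1 \<le> k" shows "finite (list_approx k F n)"
proof -
  have "inj_on (index_in (nd k)) {j \<in> nd k. index_in (nd k) j < n}"
    using index_in_inj[OF nd_subset] by (rule inj_on_subset) auto
  moreover have "finite (index_in (nd k) ` {j \<in> nd k. index_in (nd k) j < n})"
    by (rule finite_subset[of _ "{..<n}"]) auto
  ultimately show ?thesis using finite_imageD unfolding list_approx_def by blast
qed

text \<open>Last entries increase along the order of the nodes, so the index of a maximal node is
  the number of values with smaller last entry. Approximations therefore depend only on the range
  and not on the tree chosen for it.\<close>

lemma list_approx_from_range:
  assumes F: "list_tree k F" and k: "1 \<le> k"
  shows "list_approx k F n = {v \<in> F ` nd k. card {u \<in> F ` nd k. last u < last v} < n}"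
proof -
  have "card {u \<in> F ` nd k. last u < last (F j)} = index_in (nd k) j" if j: "j \<in> nd k" for j
  proof -
    have nn: "i \<noteq> []" "i \<in> nd_le k" if "i \<in> nd k" for i
      using that k nd_subset by (auto simp: nd_def)
    have "last (F i) < last (F j) \<longleftrightarrow> i \<prec> j" if i: "i \<in> nd k" for i
      using list_tree_last[OF F] nn[OF i] nn[OF j] prec_linear[of i j] by (metis less_asym less_irrefl)
    then have "{u \<in> F ` nd k. last u < last (F j)} = F ` {i \<in> nd k. i \<prec> j}" by auto
    moreover have "inj_on F {i \<in> nd k. i \<prec> j}"
      using list_tree_inj[OF F] by (rule inj_on_subset) auto
    ultimately show ?thesis by (simp add: card_image index_in_def)
  qed
  then show ?thesis by (auto simp: list_approx_def)
qed

text \<open>Without the prefix relation the comparison is settled at a first differing entry, which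
  appending does not touch.\<close>

lemma lexord_pad:
  assumes "(u, l) \<in> lexord less_than" "\<not> prefix u l"
  shows "(u @ w, l) \<in> lexord less_than"
proof -
  obtain x a b v y where *: "(a::nat) < b" "u = x @ a # v" "l = x @ b # y"
    using assms by (auto simp: lexord_def prefix_def)
  then have "(x @ (a # v @ w), x @ (b # y)) \<in> lexord less_than"
    by (intro lexord_append_leftI) simp
  then show ?thesis using * by simp
qed

text \<open>If \<open>u\<close> is not a prefix of \<open>l\<close>, it is padded with copies of its
  own last entry: this keeps the list non-decreasing, keeps its last entry and keeps it below
  \<open>l\<close>. So every nonempty node before \<open>l\<close> is an initial segment of a
  maximal node that is not after \<open>l\<close>.\<close>

lemma nd_extension_below:
  assumes l: "l \<in> nd k" and u: "u \<in> nd_le k" "u \<noteq> []" "u \<prec> l"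
  shows "\<exists>j\<in>nd k. (j = l \<or> j \<prec> l) \<and> take (length u) j = u"
proof (cases "prefix u l")
  case True
  then show ?thesis using l by (auto simp: prefix_def)
next
  case False
  let ?j = "u @ replicate (k - length u) (last u)"
  have su: "sorted u" "length u \<le> k" using u by (auto simp: nd_le_def)
  have "x \<le> last u" if "x \<in> set u" for x
    using su(1) that by (cases u rule: rev_cases) (auto simp: sorted_append)
  then have "?j \<in> nd k" using su by (auto simp: nd_def sorted_append)
  moreover have "last ?j = last u" by (cases "k - length u") (auto simp: last_append)
  moreover have "l \<noteq> []" using u by (auto simp: prec_def)
  ultimately show ?thesis
    using u False lexord_pad[of u l "replicate (k - length u) (last u)"]
    by (intro bexI[of _ ?j]) (auto simp: prec_def)
qed

text \<open>For \<open>v = F j\<close> outside the approximation, the branching level is the first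
  one at which the initial segments of \<open>j\<close> pass the last node counted. The entry of
  \<open>v\<close> there exceeds all earlier entries, while the part below that level is shared with
  a value already present.\<close>

lemma list_tree_range_branching:
  assumes F: "list_tree k F" and k: "1 \<le> k" and v: "v \<in> F ` nd k"
  shows "v \<in> list_approx k F n \<union> branching (list_approx k F n)"
proof (cases "v \<in> list_approx k F n \<or> n = 0")
  case True
  then show ?thesis
  proof
    assume "n = 0"
    then have "list_approx k F n = {}" by (simp add: list_approx_def)
    moreover have "length v = k" using v list_tree_range_tuples[OF F] by (auto simp: tuples_def)
    ultimately show ?thesis using k by (auto simp: branching_def entries_def intro!: exI[of _ 0])
  qed simp
next
  case False
  \<comment> \<open>The last node counted; \<open>n - 1\<close> is its index because
    \<open>n\<close> is positive in this case.\<close>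
  let ?s = "list_approx k F n" and ?l = "nth_in (nd k) (n - 1)"
  note nd = nd_subset infinite_nd[OF k]
  obtain j where j: "j \<in> nd k" "v = F j" using v by auto
  have l: "?l \<in> nd k" "index_in (nd k) ?l = n - 1" using nth_in[OF nd] by auto
  have idx: "index_in (nd k) i < n \<longleftrightarrow> i = ?l \<or> i \<prec> ?l" if "i \<in> nd k" for i
  proof -
    have "index_in (nd k) i < n \<longleftrightarrow> index_in (nd k) i = n - 1 \<or> index_in (nd k) i < n - 1"
      using False by auto
    then show ?thesis
      using that l index_in_less_iff[OF nd_subset that l(1)] index_in_inj[OF nd_subset] by (metis inj_onD)
  qed
  have s: "?s = F ` {i \<in> nd k. i = ?l \<or> i \<prec> ?l}" unfolding list_approx_def using idx by auto
  have "\<not> (j = ?l \<or> j \<prec> ?l)" using False j idx by (auto simp: list_approx_def)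
  then have lj: "?l \<prec> j" using prec_linear by blast
  have jn: "j \<in> nd_le k" "length j = k" and ln: "?l \<in> nd_le k" "?l \<noteq> []" "length ?l = k"
    using j l(1) nd_subset k by (auto simp: nd_def)
  \<comment> \<open>The successor shifts from the length of an initial segment to the position of
    its last entry, so that \<open>v ! q\<close> is the last entry of the value at
    \<open>take (Suc q) j\<close>.\<close>
  define q where "q = (LEAST q. ?l \<prec> take (Suc q) j)"
  have ex: "?l \<prec> take (Suc (k - 1)) j" using lj jn k by simp
  have q1: "?l \<prec> take (Suc q) j" unfolding q_def by (rule LeastI[of "\<lambda>q. ?l \<prec> take (Suc q) j", OF ex])
  have "q \<le> k - 1" unfolding q_def by (rule Least_le[of "\<lambda>q. ?l \<prec> take (Suc q) j", OF ex])
  then have qk: "q < k" using k by simp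
  have vq: "v ! q = last (F (take (Suc q) j))"
  proof -
    have "F (take (Suc q) j) = take (Suc q) v" using list_tree_take[OF F jn(1)] j by simp
    moreover have "length v = k" using list_tree_length[OF F jn(1)] j jn by simp
    ultimately show ?thesis using qk by (simp add: take_Suc_conv_app_nth)
  qed
  have lastl: "last (F ?l) < v ! q"
    unfolding vq by (rule list_tree_last[OF F ln(1) take_nd_le[OF jn(1)] ln(2) q1])
  have big: "\<forall>x\<in>entries ?s. x < v ! q"
  proof
    fix x assume "x \<in> entries ?s"
    then obtain i where i: "i \<in> nd k" "i = ?l \<or> i \<prec> ?l" "x \<in> set (F i)" unfolding s entries_def by auto
    have im: "i \<in> nd_le k" "i \<noteq> []" using i k nd_subset by (auto simp: nd_def)
    have "x \<le> last (F i)" by (rule strict_sorted_le_last[OF list_tree_sorted[OF F im(1)] i(3)])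
    also have "\<dots> \<le> last (F ?l)" using i(2) list_tree_last[OF F im(1) ln(1) im(2)] by auto
    finally show "x < v ! q" using lastl by simp
  qed
  have "q = 0 \<or> (\<exists>u\<in>?s. take q u = take q v)"
  proof (cases "q = 0")
    case False
    let ?u = "take q j"
    \<comment> \<open>By minimality of \<open>q\<close> the shorter initial segment has not passed
      \<open>?l\<close>. Being shorter than \<open>k\<close> it differs from \<open>?l\<close>,
      hence it precedes \<open>?l\<close>.\<close>
    have "\<not> ?l \<prec> take (Suc (q - 1)) j"
      using not_less_Least[of "q - 1" "\<lambda>q. ?l \<prec> take (Suc q) j"] False unfolding q_def by simp
    moreover have "?u \<noteq> ?l" using qk ln jn by (metis length_take min.absorb4 nat_neq_iff)
    ultimately have "?u \<prec> ?l" using prec_linear[of ?u ?l] False by auto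
    moreover have "?u \<noteq> []" using False jn k by auto
    ultimately obtain i where i: "i \<in> nd k" "i = ?l \<or> i \<prec> ?l" "take (length ?u) i = ?u"
      using nd_extension_below[OF l(1) take_nd_le[OF jn(1)]] by blast
    have "length ?u = q" using qk jn by simp
    then have "take q i = take q j" using i(3) by simp
    then have "take q (F i) = take q v"
      using list_tree_take[OF F jn(1), of q] list_tree_take[OF F, of i q] i(1) nd_subset[of k] j by auto
    then show ?thesis using i s by auto
  qed simp
  moreover have "q < length v" using qk list_tree_length[OF F jn(1)] j jn by simp
  ultimately show ?thesis using big by (auto simp: branching_def)
qed

text \<open>If \<open>v\<close> leaves \<open>t\<close> along some \<open>u\<close> that is not in
  \<open>s\<close>, then \<open>u\<close> itself leaves \<open>s\<close>, and at an earlier level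
  \<open>p\<close>, since otherwise the shared part of \<open>v\<close> would already come from
  \<open>s\<close>. Below level \<open>q\<close> the lists \<open>u\<close> and \<open>v\<close>
  agree, so \<open>v\<close> leaves \<open>s\<close> at \<open>p\<close>.\<close>

lemma branching_trans:
  assumes "s \<subseteq> t" "t \<subseteq> s \<union> branching s"
  shows "branching t \<subseteq> branching s"
proof
  fix v assume "v \<in> branching t"
  then obtain q where q: "q < length v" "q = 0 \<or> (\<exists>u\<in>t. take q u = take q v)"
    "\<forall>x\<in>entries t. x < v ! q" by (auto simp: branching_def)
  have entries: "entries s \<subseteq> entries t" using assms(1) by (auto simp: entries_def)
  show "v \<in> branching s"
  proof (cases "q = 0 \<or> (\<exists>u\<in>s. take q u = take q v)")
    case True then show ?thesis using q entries by (auto simp: branching_def)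
  next
    case False
    then obtain u where u: "u \<in> t" "take q u = take q v" "u \<notin> s" using q(2) by auto
    then have "u \<in> branching s" using assms(2) by auto
    then obtain p where p: "p < length u" "p = 0 \<or> (\<exists>w\<in>s. take p w = take p u)"
      "\<forall>x\<in>entries s. x < u ! p" by (auto simp: branching_def)
    have "p < q"
    proof (rule ccontr)
      assume "\<not> p < q"
      then have "q \<le> p" by simp
      then have "q = 0 \<or> (\<exists>w\<in>s. take q w = take q u)"
        using p(2) by (metis le_zero_eq min.absorb1 take_take)
      then show False using False u by auto
    qed
    moreover have "take p u = take p v" using u(2) \<open>p < q\<close>
      by (metis min.absorb1 less_imp_le take_take)
    moreover have "u ! p = v ! p" using u(2) \<open>p < q\<close> by (metis nth_take)
    ultimately show ?thesis using p q(1) by (auto simp: branching_def intro!: exI[of _ p])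
  qed
qed


section \<open>Trees of sets\<close>

text \<open>The conditions of \<open>E_tree\<close> for a function of the ground model.\<close>

definition set_tree :: "nat \<Rightarrow> (nat list \<Rightarrow> nat set) \<Rightarrow> bool" where
  "set_tree k f \<longleftrightarrow>
    (\<forall>j\<in>nd_le k. f j \<in> W_hat k) \<and>
    (\<forall>m. card (f (nth_in (nd_le k) m)) = length (nth_in (nd_le k) m)) \<and>
    (\<forall>m\<ge>1. Max (f (nth_in (nd_le k) m)) < Max (f (nth_in (nd_le k) (m + 1)))) \<and>
    (\<forall>m n. (init_seg (f (nth_in (nd_le k) m)) (f (nth_in (nd_le k) n)) \<and>
        f (nth_in (nd_le k) m) \<noteq> f (nth_in (nd_le k) n)) \<longleftrightarrow>
      strict_prefix (nth_in (nd_le k) m) (nth_in (nd_le k) n))"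

text \<open>The largest set in which ranges of trees can lie; fusion starts from a positive subset
  of it.\<close>

definition Wrange :: "nat \<Rightarrow> nat list set" where
  "Wrange k = {v. sorted_wrt (<) v \<and> length v = k \<and> set v \<in> W_hat k}"

lemma finite_W_hat: "w \<in> W_hat k \<Longrightarrow> finite w"
proof -
  assume "w \<in> W_hat k"
  then obtain j where "w = W_set k j" by (auto simp: W_hat_def)
  then have "w \<subseteq> (\<lambda>q. index_in (nd_le k) (take q j)) ` {..length j}" by (auto simp: W_set_def)
  then show ?thesis using finite_subset by blast
qed

text \<open>The indices of the initial segments of a node increase with length, so the enumeration
  of \<open>W_set k j\<close> lists them in order. Cutting it at \<open>q\<close> gives the
  enumeration belonging to \<open>take q j\<close>.\<close>

lemma take_Wrange:
  assumes v: "v \<in> Wrange k" and q: "q \<le> k"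
  shows "set (take q v) \<in> W_hat k"
proof -
  obtain j where j: "j \<in> nd_le k" "set v = W_set k j" using v by (auto simp: Wrange_def W_hat_def)
  let ?h = "\<lambda>p. index_in (nd_le k) (take p j)"
  have mono: "?h p < ?h p'" if "p < p'" "p' \<le> length j" for p p'
  proof (rule index_in_mono[OF subset_refl take_nd_le[OF j(1)]], rule prec_strict_prefix)
    show "sorted (take p' j)" using j by (simp add: nd_le_def sorted_wrt_take)
    have "take p j = take p (take p' j)" using that by simp
    then show "strict_prefix (take p j) (take p' j)"
      using that by (metis length_take min.absorb2 less_imp_le_nat nat_less_le order.trans
          strict_prefix_def take_is_prefix)
  qed
  \<comment> \<open>The list starts with the initial segment of length 1, because
    \<open>W_set\<close> leaves out the empty one.\<close>
  let ?w = "map ?h [1..<Suc (length j)]"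
  have "sorted_wrt (<) ?w"
    by (rule sorted_wrt_map_mono[of "(<)"]) (auto intro!: mono simp del: upt_Suc)
  moreover have setw: "set ?w = W_set k j" by (auto simp: W_set_def)
  ultimately have vw: "v = ?w"
    using strict_sorted_equal[of v ?w] v j by (simp add: Wrange_def)
  then have "length j = k" using v by (simp add: Wrange_def del: upt_Suc)
  then have "set (take q v) = ?h ` {1..<Suc q}"
    unfolding vw using q by (simp add: take_map take_upt min_def del: upt_Suc)
  also have "\<dots> = W_set k (take q j)"
    using q \<open>length j = k\<close> by (force simp: W_set_def min_def)
  finally show ?thesis using take_nd_le[OF j(1)] by (simp add: W_hat_def)
qed

text \<open>All elements of \<open>b - a\<close> lie above \<open>a\<close>, so the enumeration of
  \<open>a\<close> followed by that of \<open>b - a\<close> enumerates \<open>b\<close>.\<close>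

lemma init_seg_take:
  assumes "init_seg a b" "finite b"
  shows "sorted_list_of_set a = take (card a) (sorted_list_of_set b)"
proof -
  let ?c = "b - a"
  have a: "a \<subseteq> b" "finite a" using assms finite_subset by (auto simp: init_seg_def)
  have lt: "x < y" if "x \<in> a" "y \<in> ?c" for x y
    using assms(1) that by (metis DiffD1 DiffD2 init_seg_def nat_neq_iff)
  have "sorted_wrt (<) (sorted_list_of_set a @ sorted_list_of_set ?c)"
    using a assms(2) lt by (auto simp: sorted_wrt_append)
  moreover have "set (sorted_list_of_set a @ sorted_list_of_set ?c) = set (sorted_list_of_set b)"
    using a assms(2) by auto
  ultimately have "sorted_list_of_set a @ sorted_list_of_set ?c = sorted_list_of_set b"
    using strict_sorted_equal by (metis strict_sorted_list_of_set)
  then show ?thesis by (metis append_eq_conv_conj length_sorted_list_of_set)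
qed

lemma last_strict_sorted:
  assumes "sorted_wrt (<) v" "v \<noteq> []" shows "last v = Max (set (v :: nat list))"
proof (rule Max_eqI[symmetric])
  show "y \<le> last v" if "y \<in> set v" for y using strict_sorted_le_last[OF assms(1) that] .
qed (use assms in auto)

lemma set_tree_W_hat: "set_tree k f \<Longrightarrow> j \<in> nd_le k \<Longrightarrow> f j \<in> W_hat k"
  by (simp add: set_tree_def)

text \<open>The condition on initial segments makes enumerations commute with \<open>take\<close>,
  and the condition on consecutive maxima extends by induction to all pairs of nonempty nodes, the
  maximum being the last entry of the enumeration.\<close>

lemma set_tree_list_tree:
  assumes k: "1 \<le> k" and f: "set_tree k f"
  shows "list_tree k (\<lambda>j. sorted_list_of_set (f j))"
proof -
  let ?e = "nth_in (nd_le k)"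
  note nd = subset_refl[of "nd_le k"] infinite_nd_le[OF k]
  have e: "\<exists>m. j = ?e m" if "j \<in> nd_le k" for j
    using nth_in_index[OF nd that] by metis
  have fin: "finite (f j)" if "j \<in> nd_le k" for j using f that finite_W_hat by (auto simp: set_tree_def)
  have card: "card (f j) = length j" if "j \<in> nd_le k" for j
    using e[OF that] f by (auto simp: set_tree_def)
  have Max: "Max (f (?e m)) < Max (f (?e n))" if "1 \<le> m" "m < n" for m n
    using that(2)
  proof (induction n)
    case (Suc n)
    have step: "Max (f (?e n')) < Max (f (?e (Suc n')))" if "1 \<le> n'" for n'
      using f that by (simp add: set_tree_def)
    show ?case
    proof (cases "m = n")
      case True then show ?thesis using step that by simp
    next
      case False
      then show ?thesis using Suc step[of n] that by simp
    qed
  qed simp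
  show ?thesis unfolding list_tree_def
  proof (intro conjI ballI allI impI)
    fix j assume j: "j \<in> nd_le k"
    show "length (sorted_list_of_set (f j)) = length j" using card[OF j] by simp
    show "sorted_wrt (<) (sorted_list_of_set (f j))" by simp
    fix q
    show "sorted_list_of_set (f (take q j)) = take q (sorted_list_of_set (f j))"
    proof (cases "q < length j")
      case True
      have t: "take q j \<in> nd_le k" by (rule take_nd_le[OF j])
      have "strict_prefix (take q j) j"
        using True by (metis length_take min.absorb4 nat_less_le strict_prefix_def take_is_prefix)
      then have "init_seg (f (take q j)) (f j)"
        using e[OF j] e[OF t] f unfolding set_tree_def by metis
      from init_seg_take[OF this fin[OF j]] show ?thesis using card[OF t] True by simp
    next
      case False
      then show ?thesis using card[OF j] by simp
    qed
  next
    fix i j assume ij: "i \<in> nd_le k" "j \<in> nd_le k" "i \<noteq> []" "i \<prec> j"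
    obtain m n where mn: "i = ?e m" "j = ?e n" using e ij by blast
    then have "m < n" using ij nth_in_prec_iff[OF nd] by simp
    \<comment> \<open>Index 0 belongs to the empty node, whose value has no meaningful
      maximum.\<close>
    moreover have "1 \<le> m" using ij mn nth_in_nd_le_0[OF k] by (cases m) auto
    ultimately have "Max (f i) < Max (f j)" using Max mn by simp
    moreover have "last (sorted_list_of_set (f j)) = Max (f j)" if "j \<in> nd_le k" "j \<noteq> []" for j
    proof -
      have "f j \<noteq> {}" using card[OF that(1)] that(2) by auto
      then show ?thesis
        using last_strict_sorted[of "sorted_list_of_set (f j)"] fin[OF that(1)] by simp
    qed
    moreover have "j \<noteq> []" using ij by (auto simp: prec_def)
    ultimately show "last (sorted_list_of_set (f i)) < last (sorted_list_of_set (f j))"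
      using ij by simp
  qed
qed

lemma set_tree_range:
  assumes k: "1 \<le> k" and f: "set_tree k f"
  shows "(\<lambda>j. sorted_list_of_set (f j)) ` nd k \<subseteq> Wrange k"
proof safe
  fix j assume "j \<in> nd k"
  then have j: "j \<in> nd_le k" "length j = k" using nd_subset by (auto simp: nd_def)
  show "sorted_list_of_set (f j) \<in> Wrange k"
    using set_tree_W_hat[OF f j(1)] finite_W_hat list_tree_length[OF set_tree_list_tree[OF k f] j(1)] j
    by (auto simp: Wrange_def)
qed

text \<open>A list tree may take arbitrary increasing lists as values, hence the separate assumption
  that they enumerate members of \<open>W_hat k\<close>.\<close>

lemma list_tree_set_tree:
  assumes k: "1 \<le> k" and F: "list_tree k F" and W: "\<And>j. j \<in> nd_le k \<Longrightarrow> set (F j) \<in> W_hat k"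
  shows "set_tree k (\<lambda>j. set (F j))"
proof -
  let ?e = "nth_in (nd_le k)"
  note nd = subset_refl[of "nd_le k"] infinite_nd_le[OF k]
  have e: "?e m \<in> nd_le k" for m by (rule nth_in_mem[OF nd])
  have slos: "sorted_list_of_set (set (F j)) = F j" if "j \<in> nd_le k" for j
    using list_tree_sorted[OF F that] by (simp add: sorted_list_of_set.idem_if_sorted_distinct strict_sorted_iff)
  have card: "card (set (F j)) = length j" if "j \<in> nd_le k" for j
    using list_tree_sorted[OF F that] list_tree_length[OF F that] by (simp add: distinct_card strict_sorted_iff)
  show ?thesis unfolding set_tree_def
  proof (intro conjI ballI allI impI)
    show "set (F j) \<in> W_hat k" if "j \<in> nd_le k" for j using W that .
    show "card (set (F (?e m))) = length (?e m)" for m by (rule card[OF e])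
  next
    fix m :: nat assume m: "1 \<le> m"
    have nn: "?e n \<noteq> []" if "1 \<le> n" for n
    proof
      assume "?e n = []"
      moreover have "?e 0 \<prec> ?e n" using nth_in_prec_iff[OF nd, of 0 n] that by simp
      ultimately show False by (simp add: prec_def)
    qed
    have "last (F (?e m)) < last (F (?e (m + 1)))"
      by (rule list_tree_last[OF F e e nn[OF m]]) (simp add: nth_in_prec_iff[OF nd])
    moreover have "F (?e n) \<noteq> []" if "1 \<le> n" for n
      using nn[OF that] list_tree_length[OF F e] by (metis length_0_conv)
    ultimately show "Max (set (F (?e m))) < Max (set (F (?e (m + 1))))"
      using m by (simp add: last_strict_sorted[symmetric] list_tree_sorted[OF F e])
  next
    fix m n
    let ?i = "?e m" and ?j = "?e n"
    show "(init_seg (set (F ?i)) (set (F ?j)) \<and> set (F ?i) \<noteq> set (F ?j)) = strict_prefix ?i ?j"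
    proof
      assume *: "init_seg (set (F ?i)) (set (F ?j)) \<and> set (F ?i) \<noteq> set (F ?j)"
      \<comment> \<open>From here the value at \<open>?i\<close> equals the value at an initial
        segment of \<open>?j\<close> of the same length; comparable distinct nodes have different
        last entries, so the two nodes coincide.\<close>
      then have "F ?i = take (length ?i) (F ?j)"
        using init_seg_take[of "set (F ?i)" "set (F ?j)"] slos[OF e] card[OF e] by simp
      also have "\<dots> = F (take (length ?i) ?j)" using list_tree_take[OF F e] by simp
      finally have eq: "F ?i = F (take (length ?i) ?j)" .
      have t: "take (length ?i) ?j \<in> nd_le k" by (rule take_nd_le[OF e])
      have "?i = take (length ?i) ?j"
      proof (rule ccontr)
        assume ne: "?i \<noteq> take (length ?i) ?j"
        moreover have "length (take (length ?i) ?j) = length ?i"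
          using eq list_tree_length[OF F e] list_tree_length[OF F t] by metis
        ultimately have "?i \<noteq> []" "take (length ?i) ?j \<noteq> []" by auto
        then show False
          using ne prec_linear[of ?i "take (length ?i) ?j"] eq list_tree_last[OF F e t] list_tree_last[OF F t e]
          by (metis less_irrefl)
      qed
      moreover have "?i \<noteq> ?j" using * by auto
      ultimately show "strict_prefix ?i ?j" by (metis strict_prefix_def take_is_prefix)
    next
      assume sp: "strict_prefix ?i ?j"
      then have p: "?i = take (length ?i) ?j" "length ?i < length ?j"
        by (auto simp: strict_prefix_def prefix_def)
      then have Fi: "F ?i = take (length ?i) (F ?j)" using list_tree_take[OF F e] by metis
      then obtain u where u: "F ?j = F ?i @ u" by (metis append_take_drop_id)
      have "sorted_wrt (<) (F ?i @ u)" using list_tree_sorted[OF F e, of n] u by simp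
      then have "init_seg (set (F ?i)) (set (F ?j))"
        unfolding init_seg_def u by (auto simp: sorted_wrt_append dest: less_asym)
      moreover have "card (set (F ?i)) \<noteq> card (set (F ?j))" using card[OF e] p by simp
      ultimately show "init_seg (set (F ?i)) (set (F ?j)) \<and> set (F ?i) \<noteq> set (F ?j)" by auto
    qed
  qed
qed


section \<open>Fusion\<close>

text \<open>The first alternative speaks of some superset \<open>C\<close> of the continuation and
  not of the continuation itself. In this form both alternatives pass to smaller \<open>Z\<close>
  for an arbitrary predicate \<open>omits\<close>, which lets decisions survive later
  thinning.\<close>

definition decides ::
  "nat \<Rightarrow> (nat list set \<Rightarrow> nat \<Rightarrow> bool) \<Rightarrow> nat list set \<Rightarrow> nat list set \<Rightarrow> nat \<Rightarrow> bool"
where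
  "decides k omits Z s i \<longleftrightarrow>
    (\<exists>C. continuation Z s \<subseteq> C \<and> omits C i) \<or>
    \<not> (\<exists>C. s \<subseteq> C \<and> C \<subseteq> continuation Z s \<and> full_over k C s \<and> omits C i)"

lemma decides_mono:
  assumes "Z' \<subseteq> Z" "decides k omits Z s i" shows "decides k omits Z' s i"
proof -
  have "continuation Z' s \<subseteq> continuation Z s" using assms(1) by (auto simp: continuation_def)
  then show ?thesis using assms(2) unfolding decides_def by (meson order_trans)
qed

text \<open>\<open>T\<close> is the part of the tree built so far and \<open>M\<close> a bound for
  its entries that is attained in \<open>s\<close>. An element of \<open>branching s\<close> that
  extends a node \<open>t\<close> of \<open>T\<close> must leave \<open>s\<close> at or beyond the
  level of \<open>t\<close>, as its entry there exceeds \<open>M\<close>; so \<open>t\<close> is the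
  root or a node of \<open>s\<close>, where fullness of \<open>C\<close> protects it.\<close>

lemma thin_one:
  assumes T: "\<And>t. t \<in> T \<Longrightarrow> length t \<le> k \<and> positive (k - length t) (fiber Z t)"
    and s: "s \<subseteq> T" "s \<subseteq> tuples k" and M: "M \<in> entries s" "\<And>t x. t \<in> T \<Longrightarrow> x \<in> set t \<Longrightarrow> x \<le> M"
  shows "\<exists>Z'\<subseteq>Z. (\<forall>t\<in>T. positive (k - length t) (fiber Z' t)) \<and> decides k omits Z' s i"
proof (cases "\<exists>C. s \<subseteq> C \<and> C \<subseteq> continuation Z s \<and> full_over k C s \<and> omits C i")
  case False
  then have "decides k omits Z s i" by (simp add: decides_def)
  then show ?thesis using T by (intro exI[of _ Z]) auto
next
  case True
  then obtain C where C: "s \<subseteq> C" "C \<subseteq> continuation Z s" "full_over k C s" "omits C i" by blast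
  \<comment> \<open>nodes outside \<open>s\<close> have no extension in \<open>branching s\<close>, so nothing is removed above them\<close>
  define Z' where "Z' = Z - (branching s - C)"
  have "s \<subseteq> Z"
  proof
    fix u assume u: "u \<in> s"
    then have "length u = k" using s by (auto simp: tuples_def)
    then show "u \<in> Z" using T[of u] u s by (auto simp: fiber_def)
  qed
  then have CZ: "C \<subseteq> Z'" using C(2) by (auto simp: Z'_def continuation_def)
  have "continuation Z' s \<subseteq> C" using C(1) by (auto simp: continuation_def Z'_def)
  then have "decides k omits Z' s i" using C(4) by (auto simp: decides_def)
  moreover have "positive (k - length t) (fiber Z' t)" if t: "t \<in> T" for t
  proof (cases "t = [] \<or> (\<exists>u\<in>s. take (length t) u = t)")
    case True
    have "positive (k - length t) (fiber C t)"
      using True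
    proof
      assume "t = []" then show ?thesis using C(3) by (simp add: full_over_def)
    next
      assume "\<exists>u\<in>s. take (length t) u = t"
      then obtain u where u: "u \<in> s" "take (length t) u = t" by blast
      then have "positive (k - length t) (fiber C (take (length t) u))"
        using C(3) T[OF t] unfolding full_over_def by blast
      then show ?thesis using u by simp
    qed
    then show ?thesis using fiber_mono[OF CZ] by (rule positive_mono)
  next
    case False
    have "fiber Z t \<subseteq> fiber Z' t"
    proof
      fix w assume w: "w \<in> fiber Z t"
      have "t @ w \<notin> branching s"
      proof
        assume "t @ w \<in> branching s"
        then obtain q where q: "q = 0 \<or> (\<exists>u\<in>s. take q u = take q (t @ w))"
          "\<forall>x\<in>entries s. x < (t @ w) ! q" by (auto simp: branching_def)
        show False
        proof (cases "q < length t")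
          case True
          then have "t ! q \<le> M" using M(2)[OF t] by simp
          then show False using q(2) M(1) True by (auto simp: nth_append)
        next
          case q': False
          then obtain u where u: "u \<in> s" "take q u = take q (t @ w)" using q(1) False by auto
          have "take (length t) u = take (length t) (take q u)" using q' by (simp add: min_def)
          also have "\<dots> = t" using u(2) q' by simp
          finally show False using False u(1) by blast
        qed
      qed
      then show "w \<in> fiber Z' t" using w by (simp add: fiber_def Z'_def)
    qed
    with conjunct2[OF T[OF t]] show ?thesis by (rule positive_mono)
  qed
  moreover have "Z' \<subseteq> Z" by (auto simp: Z'_def)
  ultimately show ?thesis by blast
qed

text \<open>The pairs are treated one after the other; earlier decisions persist by
  \<open>decides_mono\<close>.\<close>

lemma thin_many:
  assumes "finite P"
    and "\<And>t. t \<in> T \<Longrightarrow> length t \<le> k \<and> positive (k - length t) (fiber Z t)"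
    and "\<And>s i. (s, i) \<in> P \<Longrightarrow> s \<subseteq> T \<and> s \<subseteq> tuples k \<and> M \<in> entries s"
    and "\<And>t x. t \<in> T \<Longrightarrow> x \<in> set t \<Longrightarrow> x \<le> M"
  shows "\<exists>Z'\<subseteq>Z. (\<forall>t\<in>T. positive (k - length t) (fiber Z' t)) \<and> (\<forall>(s, i)\<in>P. decides k omits Z' s i)"
  using assms(1,3)
proof (induction P)
  case empty
  then show ?case using assms(2) by (intro exI[of _ Z]) auto
next
  case (insert x P)
  obtain s i where x: "x = (s, i)" by (cases x)
  obtain Z1 where Z1: "Z1 \<subseteq> Z" "\<forall>t\<in>T. positive (k - length t) (fiber Z1 t)"
    "\<forall>(s, i)\<in>P. decides k omits Z1 s i"
  proof -
    have "\<exists>Z'\<subseteq>Z. (\<forall>t\<in>T. positive (k - length t) (fiber Z' t)) \<and> (\<forall>(s, i)\<in>P. decides k omits Z' s i)"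
      by (rule insert.IH) (use insert.prems in blast)
    then show thesis using that by blast
  qed
  have "\<exists>Z'\<subseteq>Z1. (\<forall>t\<in>T. positive (k - length t) (fiber Z' t)) \<and> decides k omits Z' s i"
    using Z1 assms(2,4) insert.prems[of s i] x by (intro thin_one[where M = M]) auto
  then obtain Z2 where Z2: "Z2 \<subseteq> Z1" "\<forall>t\<in>T. positive (k - length t) (fiber Z2 t)" "decides k omits Z2 s i"
    by blast
  have "\<forall>(s, i)\<in>insert x P. decides k omits Z2 s i"
    using Z1(3) Z2(3) x decides_mono[OF Z2(1)] by auto
  then show ?case using Z1(1) Z2 by (meson order_trans)
qed

text \<open>Nodes receive values in order of their indices while the reservoir \<open>Z\<close>
  shrinks. After the \<open>m\<close>-th value is chosen, all pairs \<open>(s, i)\<close> are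
  decided for which \<open>s\<close> contains that value and only values chosen so far, and
  \<open>i\<close> is at most its last entry. A finite subset of the final range is decided at the
  stage of its largest index.\<close>

lemma fusion:
  assumes k: "1 \<le> k" and A: "A \<subseteq> Wrange k" "positive k A"
  obtains F where "list_tree k F" "\<And>j. j \<in> nd_le k \<Longrightarrow> set (F j) \<in> W_hat k" "F ` nd k \<subseteq> A"
    "\<And>s i x. finite s \<Longrightarrow> s \<subseteq> F ` nd k \<Longrightarrow> x \<in> entries s \<Longrightarrow> i \<le> x \<Longrightarrow> decides k omits (F ` nd k) s i"
proof -
  let ?e = "nth_in (nd_le k)" and ?ix = "index_in (nd_le k)"
  note nd = subset_refl[of "nd_le k"] infinite_nd_le[OF k]
  have e: "?e m \<in> nd_le k" for m by (rule nth_in_mem[OF nd])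
  have ix_e: "?ix (?e m) = m" for m by (rule index_nth_in[OF nd])
  have e_ix: "?e (?ix j) = j" if "j \<in> nd_le k" for j by (rule nth_in_index[OF nd that])
  \<comment> \<open>The index of the parent of the \<open>n\<close>-th node.\<close>
  define pr where "pr n = ?ix (butlast (?e n))" for n
  have e0: "?e 0 = []" by (rule nth_in_nd_le_0[OF k])
  have bl: "butlast j \<in> nd_le k" if "j \<in> nd_le k" for j
    using take_nd_le[OF that, of "length j - 1"] by (simp add: butlast_conv_take)
  have e_ne: "?e n \<noteq> []" if "0 < n" for n
    using e0 ix_e[of n] ix_e[of 0] that by auto
  have e_pr: "?e (pr n) = butlast (?e n)" for n
    unfolding pr_def by (rule e_ix[OF bl[OF e]])
  have pr_less: "pr n < n" if "0 < n" for n
  proof -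
    have "butlast (?e n) \<prec> ?e n"
    proof (rule prec_strict_prefix)
      show "sorted (?e n)" using e[of n] by (simp add: nd_le_def)
      show "strict_prefix (butlast (?e n)) (?e n)" using e_ne[OF that]
        by (cases "?e n" rule: rev_cases) (auto simp: strict_prefix_def)
    qed
    then show ?thesis using index_in_mono[OF subset_refl bl[OF e]] ix_e unfolding pr_def by metis
  qed
  \<comment> \<open>\<open>f\<close> carries the values up to index \<open>m\<close> and
    \<open>Z\<close> the reservoir. Only sets containing the newest value \<open>f m\<close> are
    decided at stage \<open>m\<close>; last entries are compared from index 1 on, since the root has
    the empty value.\<close>
  define Inv where "Inv m \<sigma> \<longleftrightarrow> (case \<sigma> of (f, Z) \<Rightarrow> Z \<subseteq> A \<and>
    (\<forall>n\<le>m. length (f n) = length (?e n) \<and> positive (k - length (f n)) (fiber Z (f n))) \<and>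
    (\<forall>n\<le>m. 0 < n \<longrightarrow> butlast (f n) = f (pr n)) \<and>
    (\<forall>n<m. 0 < n \<longrightarrow> last (f n) < last (f (Suc n))) \<and>
    (\<forall>s i. s \<subseteq> f ` {..m} \<inter> tuples k \<longrightarrow> f m \<in> s \<longrightarrow> i \<le> last (f m) \<longrightarrow> decides k omits Z s i))"
    for m and \<sigma> :: "(nat \<Rightarrow> nat list) \<times> nat list set"
  define R where "R m \<sigma> \<tau> \<longleftrightarrow> snd \<tau> \<subseteq> snd \<sigma> \<and> (\<forall>n\<le>m. fst \<tau> n = fst \<sigma> n)"
    for m :: nat and \<sigma> \<tau> :: "(nat \<Rightarrow> nat list) \<times> nat list set"
  have "\<exists>\<sigma>. \<forall>m. Inv m (\<sigma> m) \<and> R m (\<sigma> m) (\<sigma> (Suc m))"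
  proof (rule dependent_nat_choice)
    \<comment> \<open>There is nothing to decide at stage 0: the empty list is not a
      \<open>k\<close>-tuple.\<close>
    have "Inv 0 (\<lambda>_. [], A)"
      using A k e0 by (auto simp: Inv_def tuples_def)
    then show "\<exists>\<sigma>. Inv 0 \<sigma>" by blast
  next
    fix \<sigma> m assume "Inv m \<sigma>"
    obtain f Z where \<sigma>: "\<sigma> = (f, Z)" by (cases \<sigma>)
    have ZA: "Z \<subseteq> A"
      and len: "\<And>n. n \<le> m \<Longrightarrow> length (f n) = length (?e n)"
      and fpos: "\<And>n. n \<le> m \<Longrightarrow> positive (k - length (f n)) (fiber Z (f n))"
      and pref: "\<And>n. n \<le> m \<Longrightarrow> 0 < n \<Longrightarrow> butlast (f n) = f (pr n)"
      and last: "\<And>n. n < m \<Longrightarrow> 0 < n \<Longrightarrow> last (f n) < last (f (Suc n))"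
      using \<open>Inv m \<sigma>\<close> unfolding Inv_def \<sigma> by auto
    let ?t = "f (pr (Suc m))"
    have pm: "pr (Suc m) \<le> m" using pr_less[of "Suc m"] by simp
    have lt: "Suc (length ?t) = length (?e (Suc m))"
      using len[OF pm] e_pr[of "Suc m"] e_ne[of "Suc m"] by simp
    then have ltk: "length ?t < k" using e[of "Suc m"] by (simp add: nd_le_def)
    then obtain d where d: "k - length ?t = Suc d" by (metis Suc_diff_Suc)
    have "infinite {x. positive d (fiber Z (?t @ [x]))}"
      using fpos[OF pm] unfolding d by (simp add: fiber_fiber_Cons)
    \<comment> \<open>An entry \<open>x\<close> above all entries used so far makes the last entries
      increase, and \<open>x\<close> then serves as the attained bound in
      \<open>thin_many\<close>.\<close>
    moreover define b where "b = Max (insert 0 (\<Union>n\<le>m. set (f n)))"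
    ultimately obtain x where x: "b < x" "positive d (fiber Z (?t @ [x]))"
      unfolding infinite_nat_iff_unbounded by blast
    have b: "y \<le> b" if "n \<le> m" "y \<in> set (f n)" for n y
      unfolding b_def using that by (intro Max_ge) auto
    define f' where "f' = f (Suc m := ?t @ [x])"
    let ?T = "f' ` {..Suc m}"
    have f'[simp]: "n \<le> m \<Longrightarrow> f' n = f n" "f' (Suc m) = ?t @ [x]" for n by (auto simp: f'_def)
    have len': "length (f' n) = length (?e n) \<and> positive (k - length (f' n)) (fiber Z (f' n))"
      if "n \<le> Suc m" for n
    proof (cases "n = Suc m")
      case True
      moreover have "k - length (?t @ [x]) = d" using d by simp
      ultimately show ?thesis using lt x by simp
    qed (use that len fpos in simp)
    have bound: "y \<le> x" if ty: "t \<in> ?T" "y \<in> set t" for t y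
    proof -
      obtain n where n: "t = f' n" "n \<in> {..Suc m}" using ty(1) by (rule imageE)
      show ?thesis
      proof (cases "n = Suc m")
        case True
        then show ?thesis using n ty(2) b[OF pm] x(1) by (auto dest: order_trans[OF _ less_imp_le])
      next
        case False
        then show ?thesis using n ty(2) b[of n y] x(1) by simp
      qed
    qed
    define P where "P = {s. s \<subseteq> ?T \<inter> tuples k \<and> f' (Suc m) \<in> s} \<times> {..x}"
    have "\<exists>Z'\<subseteq>Z. (\<forall>t\<in>?T. positive (k - length t) (fiber Z' t)) \<and> (\<forall>(s, i)\<in>P. decides k omits Z' s i)"
    proof (rule thin_many[where M = x])
      have "finite {s. s \<subseteq> ?T \<inter> tuples k \<and> f' (Suc m) \<in> s}"
        by (rule finite_subset[of _ "Pow ?T"]) auto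
      then show "finite P" by (simp add: P_def)
      show "length t \<le> k \<and> positive (k - length t) (fiber Z t)" if tT: "t \<in> ?T" for t
      proof -
        obtain n where n: "t = f' n" "n \<in> {..Suc m}" using tT by (rule imageE)
        then have "n \<le> Suc m" by simp
        moreover have "length (?e n) \<le> k" using e[of n] by (simp add: nd_le_def)
        ultimately show ?thesis using len'[of n] n(1) by metis
      qed
      show "s \<subseteq> ?T \<and> s \<subseteq> tuples k \<and> x \<in> entries s" if "(s, i) \<in> P" for s i
      proof -
        have "?t @ [x] \<in> s" "s \<subseteq> ?T \<inter> tuples k" using that by (auto simp: P_def)
        moreover have "x \<in> set (?t @ [x])" by simp
        ultimately show ?thesis unfolding entries_def by blast
      qed
    qed (use bound in blast)
    then obtain Z' where Z': "Z' \<subseteq> Z" "\<And>t. t \<in> ?T \<Longrightarrow> positive (k - length t) (fiber Z' t)"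
      "\<And>s i. (s, i) \<in> P \<Longrightarrow> decides k omits Z' s i" by blast
    have "Inv (Suc m) (f', Z')" unfolding Inv_def prod.case
    proof (intro conjI allI impI)
      show "Z' \<subseteq> A" using Z' ZA by auto
      fix n assume n: "n \<le> Suc m"
      show "length (f' n) = length (?e n)" using len'[OF n] by blast
      show "positive (k - length (f' n)) (fiber Z' (f' n))" using Z'(2)[of "f' n"] n by simp
      assume n0: "0 < n"
      then have "pr n \<le> m" using pr_less[OF n0] n by simp
      then show "butlast (f' n) = f' (pr n)"
        using pref n n0 by (cases "n = Suc m") auto
    next
      fix n assume n: "n < Suc m" "0 < n"
      show "last (f' n) < last (f' (Suc n))"
      proof (cases "n = m")
        case True
        have "length (f m) = length (?e m)" using len by simp
        then have "f m \<noteq> []" using e_ne[OF n(2)] True by auto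
        then have "last (f m) \<le> b" using b[of m] by simp
        then show ?thesis using True x by simp
      qed (use n last in simp)
    next
      fix s i assume "s \<subseteq> ?T \<inter> tuples k" "f' (Suc m) \<in> s" "i \<le> last (f' (Suc m))"
      then have "(s, i) \<in> P" by (simp add: P_def)
      then show "decides k omits Z' s i" by (rule Z'(3))
    qed
    moreover have "R m \<sigma> (f', Z')" using Z' \<sigma> by (simp add: R_def)
    ultimately show "\<exists>\<tau>. Inv (Suc m) \<tau> \<and> R m \<sigma> \<tau>" by blast
  qed
  then obtain \<sigma> where \<sigma>: "\<And>m. Inv m (\<sigma> m)" "\<And>m. R m (\<sigma> m) (\<sigma> (Suc m))" by blast
  \<comment> \<open>The value at index \<open>n\<close> is final from stage \<open>n\<close>
    on.\<close>
  define g where "g n = fst (\<sigma> n) n" for n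
  define Z where "Z m = snd (\<sigma> m)" for m
  have g: "fst (\<sigma> m) n = g n" if "n \<le> m" for m n
    using that
  proof (induction m)
    case (Suc m)
    then show ?case using \<sigma>(2)[of m] by (cases "n = Suc m") (auto simp: g_def R_def)
  qed (simp add: g_def)
  have Zmono: "Z n \<subseteq> Z m" if "m \<le> n" for m n
    using that
  proof (rule lift_Suc_antimono_le[of Z, rotated])
    show "Z (Suc n) \<subseteq> Z n" for n using \<sigma>(2)[of n] by (simp add: R_def Z_def)
  qed
  have inv: "Z m \<subseteq> A"
      "n \<le> m \<Longrightarrow> length (g n) = length (?e n)"
      "n \<le> m \<Longrightarrow> positive (k - length (g n)) (fiber (Z m) (g n))"
      "n \<le> m \<Longrightarrow> 0 < n \<Longrightarrow> butlast (g n) = g (pr n)"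
      "n < m \<Longrightarrow> 0 < n \<Longrightarrow> last (g n) < last (g (Suc n))"
      "s \<subseteq> g ` {..m} \<inter> tuples k \<Longrightarrow> g m \<in> s \<Longrightarrow> i \<le> last (g m) \<Longrightarrow> decides k omits (Z m) s i"
    for m n s i
  proof -
    have "\<sigma> m = (fst (\<sigma> m), Z m)" by (simp add: Z_def)
    with \<sigma>(1)[of m] have I: "Inv m (fst (\<sigma> m), Z m)" by simp
    have im: "fst (\<sigma> m) ` {..m} = g ` {..m}" using g by auto
    have gm: "fst (\<sigma> m) m = g m" using g by simp
    note I = I[unfolded Inv_def prod.case im gm]
    show "Z m \<subseteq> A" using I by blast
    show "n \<le> m \<Longrightarrow> length (g n) = length (?e n)" using I g[of n m] by metis
    show "n \<le> m \<Longrightarrow> positive (k - length (g n)) (fiber (Z m) (g n))" using I g[of n m] by metis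
    show "n \<le> m \<Longrightarrow> 0 < n \<Longrightarrow> butlast (g n) = g (pr n)"
      using I g[of n m] g[of "pr n" m] pr_less[of n] by (metis less_imp_le order_trans)
    show "n < m \<Longrightarrow> 0 < n \<Longrightarrow> last (g n) < last (g (Suc n))"
      using I g[of n m] g[of "Suc n" m] by (metis Suc_leI less_imp_le)
    show "s \<subseteq> g ` {..m} \<inter> tuples k \<Longrightarrow> g m \<in> s \<Longrightarrow> i \<le> last (g m) \<Longrightarrow> decides k omits (Z m) s i"
      using I by blast
  qed
  have last_mono: "last (g m) < last (g n)" if "0 < m" "m < n" for m n
    using that(2)
  proof (induction n)
    case (Suc n)
    show ?case
    proof (cases "m = n")
      case True then show ?thesis using inv(5)[of n "Suc n"] that by simp
    next
      case False
      then show ?thesis using Suc inv(5)[of n "Suc n"] that by simp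
    qed
  qed simp
  \<comment> \<open>A positive fiber is nonempty, so every value is an initial segment of a member
    of \<open>A\<close>. This makes it increasing and places its entries in
    \<open>W_hat k\<close>.\<close>
  have inA: "\<exists>v\<in>A. take (length (g n)) v = g n \<and> length (g n) \<le> k" for n
  proof -
    obtain u where u: "u \<in> fiber (Z n) (g n)" "length u = k - length (g n)"
      using positive_nonempty[OF inv(3)[of n n]] by auto
    moreover have "length (g n) \<le> k" using inv(2)[of n n] e[of n] by (simp add: nd_le_def)
    ultimately show ?thesis
      using inv(1)[of n] by (intro bexI[of _ "g n @ u"]) (auto simp: fiber_def)
  qed
  define F where "F j = g (?ix j)" for j
  have Fe: "F (?e n) = g n" for n by (simp add: F_def ix_e)
  have W: "set (F j) \<in> W_hat k" "sorted_wrt (<) (F j)" for j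
  proof -
    obtain v where v: "v \<in> A" "take (length (F j)) v = F j" "length (F j) \<le> k"
      using inA[of "?ix j"] by (auto simp: F_def)
    then have "v \<in> Wrange k" using A by auto
    then show "set (F j) \<in> W_hat k" "sorted_wrt (<) (F j)"
      using take_Wrange[of v k "length (F j)"] v sorted_wrt_take[of "(<)" v "length (F j)"]
      by (simp_all add: Wrange_def)
  qed
  have Flen: "length (F j) = length j" if "j \<in> nd_le k" for j
    using inv(2)[of "?ix j" "?ix j"] e_ix[OF that] by (simp add: F_def)
  have Fbl: "F (butlast j) = butlast (F j)" if "j \<in> nd_le k" "j \<noteq> []" for j
  proof -
    have "0 < ?ix j" using e_ix[OF that(1)] e0 that(2) by (metis gr0I)
    then show ?thesis
      using inv(4)[of "?ix j" "?ix j"] e_ix[OF that(1)] by (simp add: F_def pr_def)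
  qed
  have Ftake: "F (take q j) = take q (F j)" if "j \<in> nd_le k" for q j
    using that
  proof (induction "length j" arbitrary: j)
    case 0
    then show ?case using Flen[of j] by simp
  next
    case (Suc n)
    show ?case
    proof (cases "q < length j")
      case True
      have "F (take q (butlast j)) = take q (F (butlast j))"
        by (rule Suc.hyps(1)) (use Suc.hyps(2) bl[OF Suc.prems] in auto)
      moreover have "j \<noteq> []" using Suc.hyps(2) by auto
      moreover have "take q (butlast j) = take q j" "take q (butlast (F j)) = take q (F j)"
        using True Flen[OF Suc.prems] by (auto simp: butlast_conv_take min_def)
      ultimately show ?thesis using Fbl[OF Suc.prems] by simp
    next
      case False then show ?thesis using Flen[OF Suc.prems] by simp
    qed
  qed
  have Flast: "last (F i) < last (F j)"
    if "i \<in> nd_le k" "j \<in> nd_le k" "i \<noteq> []" "i \<prec> j" for i j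
  proof -
    have "0 < ?ix i" using e_ix[OF that(1)] e0 that(3) by (metis gr0I)
    then show ?thesis
      unfolding F_def using index_in_mono[OF subset_refl that(1,4)] by (rule last_mono)
  qed
  have F: "list_tree k F" unfolding list_tree_def using Flen W Ftake Flast by blast
  have FZ: "F ` nd k \<subseteq> Z m" for m
  proof safe
    fix j assume "j \<in> nd k"
    then have j: "j \<in> nd_le k" "length j = k" using nd_subset by (auto simp: nd_def)
    let ?M = "max m (?ix j)"
    have "positive (k - length (F j)) (fiber (Z ?M) (F j))" unfolding F_def by (rule inv(3)) simp
    then have "F j \<in> Z ?M" using Flen[OF j(1)] j by (simp add: fiber_def)
    then show "F j \<in> Z m" using Zmono[of m ?M] by auto
  qed
  have "decides k omits (F ` nd k) s i"
    if s: "finite s" "s \<subseteq> F ` nd k" "x \<in> entries s" "i \<le> x" for s i x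
  proof -
    \<comment> \<open>Restricting to indices of maximal nodes excludes index 0, so last entries
      separate these indices and \<open>?J\<close> is finite along with \<open>s\<close>.\<close>
    let ?J = "{n. g n \<in> s \<and> ?e n \<in> nd k}"
    have sJ: "s = g ` ?J"
    proof
      show "s \<subseteq> g ` ?J"
      proof
        fix v assume v: "v \<in> s"
        then obtain j where j: "j \<in> nd k" "v = F j" using s(2) by auto
        then have "j \<in> nd_le k" using nd_subset by auto
        then have "?ix j \<in> ?J" "v = g (?ix j)" using j v e_ix by (auto simp: F_def)
        then show "v \<in> g ` ?J" by blast
      qed
    qed auto
    have positive_J: "0 < n" if "n \<in> ?J" for n
      using that e0 k by (intro gr0I) (auto simp: nd_def)
    have "inj_on g ?J"
    proof (rule inj_onI)
      fix a b assume "a \<in> ?J" "b \<in> ?J" "g a = g b"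
      then show "a = b" using positive_J[of a] positive_J[of b] last_mono[of a b] last_mono[of b a]
        by (cases a b rule: linorder_cases) simp_all
    qed
    then have finJ: "finite ?J" using s(1) sJ finite_imageD by metis
    have "?J \<noteq> {}" using s(3) sJ by (auto simp: entries_def)
    define m where "m = Max ?J"
    have m: "m \<in> ?J" unfolding m_def using Max_in[OF finJ \<open>?J \<noteq> {}\<close>] .
    have le_m: "n \<le> m" if "n \<in> ?J" for n unfolding m_def using Max_ge[OF finJ that] .
    \<comment> \<open>Every entry is at most the last one of its list, and last entries grow with
      the index; so \<open>i\<close> is in the range treated at stage \<open>m\<close>.\<close>
    have "x \<le> last (g m)"
    proof -
      obtain v where v: "v \<in> s" "x \<in> set v" using s(3) by (auto simp: entries_def)
      then have "v \<in> g ` ?J" using sJ by simp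
      then obtain n where n: "n \<in> ?J" "x \<in> set (g n)" using v(2) by blast
      have "x \<le> last (g n)" using strict_sorted_le_last[OF W(2)[of "?e n"]] n by (simp add: Fe)
      also have "\<dots> \<le> last (g m)" using le_m[OF n(1)] last_mono[OF positive_J[OF n(1)], of m]
        by (cases "n = m") auto
      finally show ?thesis .
    qed
    moreover have "s \<subseteq> g ` {..m} \<inter> tuples k"
      using sJ le_m s(2) list_tree_range_tuples[OF F] by blast
    ultimately have "decides k omits (Z m) s i" using inv(6)[of s m i] m s(4) by auto
    then show ?thesis by (rule decides_mono[OF FZ])
  qed
  then show thesis using that[OF F W(1)] FZ[of 0] inv(1)[of 0] by blast
qed


section \<open>The forcing relation\<close>

definition set_range :: "nat \<Rightarrow> (nat list \<Rightarrow> nat set) \<Rightarrow> nat list set" where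
  "set_range k f = (\<lambda>j. sorted_list_of_set (f j)) ` nd k"

definition set_approx :: "nat \<Rightarrow> (nat list \<Rightarrow> nat set) \<Rightarrow> nat \<Rightarrow> nat list set" where
  "set_approx k f n = list_approx k (\<lambda>j. sorted_list_of_set (f j)) n"

lemma set_approx_from_range:
  "1 \<le> k \<Longrightarrow> set_tree k f \<Longrightarrow> set_tree k f' \<Longrightarrow> set_range k f = set_range k f' \<Longrightarrow> set_approx k f n = set_approx k f' n"
  unfolding set_range_def set_approx_def by (simp add: list_approx_from_range set_tree_list_tree)

lemma set_approx_nth_in:
  assumes "1 \<le> k"
  shows "a \<in> set_approx k f n \<longleftrightarrow> (\<exists>p<n. a = sorted_list_of_set (f (nth_in (nd k) p)))"
proof -
  note nd = nd_subset infinite_nd[OF assms]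
  show ?thesis unfolding set_approx_def list_approx_def
    using nth_in_mem[OF nd] index_nth_in[OF nd] nth_in_index[OF nd] by (auto simp: image_iff) metis+
qed

lemmas forcing_defs = fGround_def fAnd_def fImp_def fIff_def fAll_def fEx_def

context
  fixes k :: nat
  assumes k: "1 \<le> k"
begin

abbreviation (input) L :: "cnd \<Rightarrow> cnd \<Rightarrow> bool" where "L \<equiv> Fin_le k"

section \<open>Persistence of sentences under stronger conditions\<close>

lemma L_trans: "L r q \<Longrightarrow> L q p \<Longrightarrow> L r p"
  by (rule Fin_le_trans[OF k])

lemma L_refl: "L q p \<Longrightarrow> L q q"
  by (rule Fin_le_refl1[OF _ k])

text \<open>A sentence is an arbitrary function of order and condition, so this property of forcing
  relations has to be established for each sentence in use.\<close>

definition persistent :: "cnd sentence \<Rightarrow> bool" where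
  "persistent \<phi> \<longleftrightarrow> (\<forall>p q. L q p \<longrightarrow> \<phi> L p \<longrightarrow> \<phi> L q)"

lemma persistentD: "persistent \<phi> \<Longrightarrow> \<phi> L p \<Longrightarrow> L q p \<Longrightarrow> \<phi> L q"
  by (auto simp: persistent_def)

lemma persistent_And: "persistent \<phi> \<Longrightarrow> persistent \<psi> \<Longrightarrow> persistent (\<phi> \<^bold>\<and> \<psi>)"
  by (simp add: persistent_def fAnd_def)

lemma persistent_Imp: "persistent (\<phi> \<^bold>\<longrightarrow> \<psi>)"
  unfolding persistent_def fImp_def using L_trans by blast

lemma persistent_Iff: "persistent (\<phi> \<^bold>\<longleftrightarrow> \<psi>)"
  unfolding fIff_def by (intro persistent_And persistent_Imp)

lemma persistent_All: "(\<And>x. persistent (\<phi> x)) \<Longrightarrow> persistent (\<^bold>\<forall>x. \<phi> x)"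
  by (simp add: persistent_def fAll_def)

lemma persistent_Ex: "persistent (\<^bold>\<exists>x. \<phi> x)"
  unfolding persistent_def fEx_def using L_trans by blast

lemma persistent_mem: "persistent (fmem eq x \<tau>)"
  unfolding persistent_def fmem_def using L_trans by blast

lemma persistent_in_set: "persistent (a \<^bold>\<in> X)"
  unfolding fin_set_def by (rule persistent_mem)

lemma persistent_eq: "persistent (X \<^bold>= Y)"
  unfolding fset_eq_def by (intro persistent_All persistent_Iff)

lemma persistent_subset: "persistent (X \<^bold>\<subseteq> Y)"
  unfolding fsubset_def by (intro persistent_All persistent_Imp)

lemma persistent_graph: "persistent (fgraph g X S)"
  unfolding fgraph_def by (rule persistent_mem)

lemma persistent_in_G: "persistent (in_G X)"
  unfolding in_G_def by (rule persistent_mem)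

lemma persistent_E_tree: "persistent (E_tree k F)"
  unfolding E_tree_def by (intro persistent_And persistent_All persistent_Imp)

lemma persistent_tree_range: "persistent (tree_range k F X)"
  unfolding tree_range_def by (intro persistent_All persistent_Iff)

lemma persistent_tree_approx: "persistent (tree_approx k n F s)"
  unfolding tree_approx_def by (intro persistent_All persistent_Iff)

lemma persistent_in_E: "persistent (in_E k X)"
  unfolding in_E_def by (rule persistent_Ex)

lemma persistent_approx: "persistent (approx k n X s)"
  unfolding approx_def by (rule persistent_Ex)

lemma persistent_in_B_below: "persistent (in_B_below k Y X)"
  unfolding in_B_below_def in_B_def
  by (intro persistent_And persistent_in_G persistent_in_E persistent_subset)

section \<open>Membership, equality and quantifiers under forcing\<close>

lemma mem_local:
  assumes "\<And>q'. L q' q \<Longrightarrow> \<exists>r. L r q' \<and> (a \<^bold>\<in> X) L r"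
  shows "(a \<^bold>\<in> X) L q"
  unfolding fin_set_def fmem_def
proof (intro allI impI)
  fix q' assume "L q' q"
  then obtain r where r: "L r q'" "(a \<^bold>\<in> X) L r" using assms by blast
  then obtain r' where "L r' r" "\<exists>(y, s)\<in>X. L r' s \<and> \<langle>a = y\<rangle> L r'"
    using L_refl[OF r(1)] unfolding fin_set_def fmem_def by blast
  then show "\<exists>r. L r q' \<and> (\<exists>(y, s)\<in>X. L r s \<and> \<langle>a = y\<rangle> L r)"
    using r(1) L_trans by blast
qed

lemma mem_check: "L q q \<Longrightarrow> (a \<^bold>\<in> check_set A) L q \<longleftrightarrow> a \<in> A"
  unfolding fin_set_def fmem_def check_set_def fGround_def using L_refl by fastforce

lemma eq_iff: "(X \<^bold>= Y) L q \<longleftrightarrow> (\<forall>a r. L r q \<longrightarrow> (a \<^bold>\<in> X) L r \<longleftrightarrow> (a \<^bold>\<in> Y) L r)"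
  by (auto simp: fset_eq_def forcing_defs)

lemma subset_iff: "(X \<^bold>\<subseteq> Y) L q \<longleftrightarrow> (\<forall>a r. L r q \<longrightarrow> (a \<^bold>\<in> X) L r \<longrightarrow> (a \<^bold>\<in> Y) L r)"
  by (auto simp: fsubset_def forcing_defs)

lemma eq_sym: "(X \<^bold>= Y) L q \<Longrightarrow> (Y \<^bold>= X) L q"
  by (simp add: eq_iff)

lemma eq_trans: "(X \<^bold>= Y) L q \<Longrightarrow> (Y \<^bold>= Z) L q \<Longrightarrow> (X \<^bold>= Z) L q"
  by (simp add: eq_iff)

lemma eq_refl: "(X \<^bold>= X) L q"
  by (simp add: eq_iff)

lemma eq_check_mem: "(X \<^bold>= check_set A) L q \<Longrightarrow> L r q \<Longrightarrow> (a \<^bold>\<in> X) L r \<longleftrightarrow> a \<in> A"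
  using mem_check[OF L_refl, of r q a A] unfolding eq_iff by simp

lemma eq_check:
  assumes "L q q" shows "(check_set A \<^bold>= check_set B) L q \<longleftrightarrow> A = B"
proof
  assume "(check_set A \<^bold>= check_set B) L q"
  from eq_check_mem[OF this assms] show "A = B" unfolding mem_check[OF assms] by blast
qed (simp add: eq_refl)

lemma All_Iff_iff:
  "(\<^bold>\<forall>a. \<phi> a \<^bold>\<longleftrightarrow> \<psi> a) L q \<longleftrightarrow> (\<forall>a r. L r q \<longrightarrow> \<phi> a L r \<longleftrightarrow> \<psi> a L r)"
  unfolding fAll_def fIff_def fAnd_def fImp_def by blast

lemma All_All_Imp_iff:
  "(\<^bold>\<forall>x y. \<phi> x y \<^bold>\<longrightarrow> \<psi> x y) L q \<longleftrightarrow> (\<forall>x y r. L r q \<longrightarrow> \<phi> x y L r \<longrightarrow> \<psi> x y L r)"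
  unfolding fAll_def fImp_def by blast

lemma Ex_D: "(\<^bold>\<exists>x. \<phi> x) L q \<Longrightarrow> L q q \<Longrightarrow> \<exists>r x. L r q \<and> \<phi> x L r"
  unfolding fEx_def by blast

lemma Ex_I:
  assumes "\<And>r. L r q \<Longrightarrow> \<phi> x L r" shows "(\<^bold>\<exists>x. \<phi> x) L q"
  unfolding fEx_def
proof (intro allI impI)
  fix q' assume "L q' q"
  then show "\<exists>r. L r q' \<and> (\<exists>x. \<phi> x L r)" using assms[of q'] L_refl[of q' q] by blast
qed

text \<open>The witnesses in the name \<open>g\<close> only have to be forced equal to the
  arguments, so transitivity of equality carries them over.\<close>

lemma graph_cong:
  assumes g: "fgraph g X S L q" and XX: "(X \<^bold>= X') L q" and SS: "(S \<^bold>= S') L q"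
  shows "fgraph g X' S' L q"
  unfolding fgraph_def fmem_def
proof (intro allI impI)
  fix q' assume q': "L q' q"
  then obtain r Y T s where r: "L r q'" "((Y, T), s) \<in> g" "L r s" "(X \<^bold>= Y) L r" "(S \<^bold>= T) L r"
    using g unfolding fgraph_def fmem_def by (fastforce simp: fAnd_def)
  have "(X' \<^bold>= Y) L r" "(S' \<^bold>= T) L r"
    using r(4,5) eq_sym eq_trans persistentD[OF persistent_eq XX L_trans[OF r(1) q']]
      persistentD[OF persistent_eq SS L_trans[OF r(1) q']] by blast+
  then have "L r s \<and> (case (X', S') of (X, S) \<Rightarrow> \<lambda>(Y, T). (X \<^bold>= Y) \<^bold>\<and> (S \<^bold>= T)) (Y, T) L r"
    using r(3) by (simp add: fAnd_def)
  then show "\<exists>r. L r q' \<and> (\<exists>(y, s)\<in>g. L r s \<and>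
      (case (X', S') of (X, S) \<Rightarrow> \<lambda>(Y, T). (X \<^bold>= Y) \<^bold>\<and> (S \<^bold>= T)) y L r)"
    using r(1,2) by blast
qed

lemma in_G_check: "L q A \<Longrightarrow> in_G (check_set A) L q"
  unfolding in_G_def fmem_def generic_name_def
  using L_trans L_refl eq_refl by blast

lemma in_G_D:
  assumes "in_G X L q" "L q q"
  shows "\<exists>r A. L r q \<and> L r A \<and> (X \<^bold>= check_set A) L r"
  using assms unfolding in_G_def fmem_def generic_name_def by blast

section \<open>Trees of the extension decided by conditions\<close>

definition decided :: "cnd \<Rightarrow> (nat list \<times> nat set, cnd) name \<Rightarrow> (nat list \<Rightarrow> nat set) \<Rightarrow> bool" where
  "decided q F f \<longleftrightarrow> E_tree k F L q \<and> set_tree k f \<and> (\<forall>j\<in>nd_le k. ((j, f j) \<^bold>\<in> F) L q)"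

lemma decided_persistent: "decided q F f \<Longrightarrow> L r q \<Longrightarrow> decided r F f"
  unfolding decided_def
  using persistentD[OF persistent_E_tree, of F q r] persistentD[OF persistent_in_set, of _ F q r] by blast

lemma E_tree_iff:
  "E_tree k F L q \<longleftrightarrow>
    (\<forall>j w r. L r q \<longrightarrow> ((j, w) \<^bold>\<in> F) L r \<longrightarrow> j \<in> nd_le k \<and> w \<in> W_hat k) \<and>
    (\<forall>j r. L r q \<longrightarrow> j \<in> nd_le k \<longrightarrow> (\<forall>q. L q r \<longrightarrow> (\<exists>r. L r q \<and> (\<exists>w. ((j, w) \<^bold>\<in> F) L r)))) \<and>
    (\<forall>j w w' r. L r q \<longrightarrow> ((j, w) \<^bold>\<in> F) L r \<and> ((j, w') \<^bold>\<in> F) L r \<longrightarrow> w = w') \<and>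
    (\<forall>m w r. L r q \<longrightarrow> ((nth_in (nd_le k) m, w) \<^bold>\<in> F) L r \<longrightarrow> card w = length (nth_in (nd_le k) m)) \<and>
    (\<forall>m w w' r. L r q \<longrightarrow> 1 \<le> m \<and> ((nth_in (nd_le k) m, w) \<^bold>\<in> F) L r \<and>
        ((nth_in (nd_le k) (m + 1), w') \<^bold>\<in> F) L r \<longrightarrow> Max w < Max w') \<and>
    (\<forall>m n w w' r. L r q \<longrightarrow> ((nth_in (nd_le k) m, w) \<^bold>\<in> F) L r \<and> ((nth_in (nd_le k) n, w') \<^bold>\<in> F) L r \<longrightarrow>
        (init_seg w w' \<and> w \<noteq> w') = strict_prefix (nth_in (nd_le k) m) (nth_in (nd_le k) n))"
  unfolding E_tree_def forcing_defs by blast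

text \<open>Totality of \<open>F\<close> makes the conditions that decide the value at the
  \<open>n\<close>-th node open and dense below \<open>q\<close>. One condition meets all countably
  many of these sets, and the tree conditions, being statements about ground model objects, transfer
  to the resulting \<open>f\<close>.\<close>

lemma E_tree_decide:
  assumes F: "E_tree k F L q" and q: "L q q"
  shows "\<exists>r f. L r q \<and> decided r F f"
proof -
  let ?e = "nth_in (nd_le k)" and ?ix = "index_in (nd_le k)"
  note nd = subset_refl[of "nd_le k"] infinite_nd_le[OF k]
  note F1 = F[unfolded E_tree_iff, THEN conjunct1]
  note F2 = F[unfolded E_tree_iff, THEN conjunct2]
  note F3 = F2[THEN conjunct2, THEN conjunct2]
  have "\<exists>r. L r q \<and> (\<forall>n. \<exists>w. ((?e n, w) \<^bold>\<in> F) L r)"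
  proof (rule Fin_le_distributive[OF k q])
    fix n q' assume "L q' q"
    then show "\<exists>r. L r q' \<and> (\<exists>w. ((?e n, w) \<^bold>\<in> F) L r)"
      using F2[THEN conjunct1] nth_in_mem[OF nd, of n] L_refl[of q' q] by blast
  next
    fix n q' r assume "\<exists>w. ((?e n, w) \<^bold>\<in> F) L q'" "L r q'"
    then show "\<exists>w. ((?e n, w) \<^bold>\<in> F) L r"
      using persistentD[OF persistent_in_set, of _ F q' r] by blast
  qed
  then obtain r W where r: "L r q" and W: "\<And>n. ((?e n, W n) \<^bold>\<in> F) L r" by metis
  define f where "f j = W (?ix j)" for j
  have fe: "f (?e m) = W m" for m by (simp add: f_def index_nth_in[OF nd])
  have mem: "((j, f j) \<^bold>\<in> F) L r" if "j \<in> nd_le k" for j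
    using W[of "?ix j"] nth_in_index[OF nd that] by (simp add: f_def)
  have "set_tree k f"
    unfolding set_tree_def fe
  proof (intro conjI ballI allI impI)
    show "f j \<in> W_hat k" if "j \<in> nd_le k" for j using F1 r mem[OF that] by blast
    show "card (W m) = length (?e m)" for m using F3[THEN conjunct1] r W[of m] by blast
    show "Max (W m) < Max (W (m + 1))" if "1 \<le> m" for m
      using F3[THEN conjunct2, THEN conjunct1] r W[of m] W[of "m + 1"] that by blast
    show "(init_seg (W m) (W n) \<and> W m \<noteq> W n) = strict_prefix (?e m) (?e n)" for m n
      using F3[THEN conjunct2, THEN conjunct2] r W[of m] W[of n] by blast
  qed
  then show ?thesis
    using r mem persistentD[OF persistent_E_tree F r] unfolding decided_def by blast
qed

text \<open>The pairs \<open>(j, f j)\<close> are forced into \<open>F\<close> by assumption; the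
  functionality clause of \<open>E_tree\<close> excludes any others.\<close>

lemma decided_mem:
  assumes "decided q F f" "L q q"
  shows "((j, w) \<^bold>\<in> F) L q \<longleftrightarrow> j \<in> nd_le k \<and> w = f j"
proof -
  have F: "E_tree k F L q" and f: "\<And>j. j \<in> nd_le k \<Longrightarrow> ((j, f j) \<^bold>\<in> F) L q"
    using assms(1) by (auto simp: decided_def)
  note F1 = F[unfolded E_tree_iff, THEN conjunct1]
  note F2 = F[unfolded E_tree_iff, THEN conjunct2, THEN conjunct2, THEN conjunct1]
  show ?thesis using F1 F2 f assms(2) by blast
qed

lemma decided_range:
  assumes d: "decided q F f" and q: "L q q"
  shows "tree_range k F X L q \<longleftrightarrow> (X \<^bold>= check_set (set_range k f)) L q"
proof -
  have "(\<^bold>\<exists>j w. \<langle>j \<in> nd k \<and> a = sorted_list_of_set w\<rangle> \<^bold>\<and> (j, w) \<^bold>\<in> F) L r \<longleftrightarrow> a \<in> set_range k f"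
    (is "?lhs \<longleftrightarrow> _") if r: "L r q" for r a
  proof
    assume ?lhs
    then obtain r1 j where r1: "L r1 r"
      "(\<^bold>\<exists>w. \<langle>j \<in> nd k \<and> a = sorted_list_of_set w\<rangle> \<^bold>\<and> (j, w) \<^bold>\<in> F) L r1"
      using Ex_D[OF _ L_refl[OF r]] by blast
    then obtain r' w where "L r' r1" and r'': "j \<in> nd k" "a = sorted_list_of_set w" "((j, w) \<^bold>\<in> F) L r'"
      using Ex_D[OF r1(2) L_refl[OF r1(1)]] by (auto simp: fAnd_def fGround_def)
    with r1 have r': "L r' r" "j \<in> nd k" "a = sorted_list_of_set w" "((j, w) \<^bold>\<in> F) L r'"
      using L_trans by auto
    then have "w = f j"
      using decided_mem[OF decided_persistent[OF d L_trans[OF r'(1) r]] L_refl[OF r'(1)]] by blast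
    then show "a \<in> set_range k f" using r' by (auto simp: set_range_def)
  next
    assume "a \<in> set_range k f"
    then obtain j where j: "j \<in> nd k" "a = sorted_list_of_set (f j)" by (auto simp: set_range_def)
    then have "j \<in> nd_le k" using nd_subset by blast
    then have "((j, f j) \<^bold>\<in> F) L r'" if "L r' r" for r'
      using decided_persistent[OF d L_trans[OF that r]] by (simp add: decided_def)
    then have "(\<langle>j \<in> nd k \<and> a = sorted_list_of_set (f j)\<rangle> \<^bold>\<and> (j, f j) \<^bold>\<in> F) L r'" if "L r' r" for r'
      using that j by (simp add: fAnd_def fGround_def)
    then show ?lhs by (intro Ex_I[where x = j] Ex_I[where x = "f j"]) (use L_trans in blast)
  qed
  then show ?thesis
    unfolding tree_range_def eq_iff All_Iff_iff by (simp add: mem_check[OF L_refl[of _ q]])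
qed

lemma decided_approx:
  assumes d: "decided q F f" and q: "L q q"
  shows "tree_approx k n F s L q \<longleftrightarrow> s = set_approx k f n"
proof -
  have "(\<^bold>\<exists>p w. \<langle>p < n \<and> a = sorted_list_of_set w\<rangle> \<^bold>\<and> (nth_in (nd k) p, w) \<^bold>\<in> F) L r \<longleftrightarrow> a \<in> set_approx k f n"
    (is "?lhs \<longleftrightarrow> _") if r: "L r q" for r a
  proof
    assume ?lhs
    then obtain r1 p where r1: "L r1 r"
      "(\<^bold>\<exists>w. \<langle>p < n \<and> a = sorted_list_of_set w\<rangle> \<^bold>\<and> (nth_in (nd k) p, w) \<^bold>\<in> F) L r1"
      using Ex_D[OF _ L_refl[OF r]] by blast
    then obtain r' w where "L r' r1" and r'': "p < n" "a = sorted_list_of_set w"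
      "((nth_in (nd k) p, w) \<^bold>\<in> F) L r'"
      using Ex_D[OF r1(2) L_refl[OF r1(1)]] by (auto simp: fAnd_def fGround_def)
    with r1 have r': "L r' r" "p < n" "a = sorted_list_of_set w" "((nth_in (nd k) p, w) \<^bold>\<in> F) L r'"
      using L_trans by auto
    then have "w = f (nth_in (nd k) p)"
      using decided_mem[OF decided_persistent[OF d L_trans[OF r'(1) r]] L_refl[OF r'(1)]] by blast
    then show "a \<in> set_approx k f n" using r' by (auto simp: set_approx_nth_in[OF k])
  next
    assume "a \<in> set_approx k f n"
    then obtain p where p: "p < n" "a = sorted_list_of_set (f (nth_in (nd k) p))"
      by (auto simp: set_approx_nth_in[OF k])
    have "nth_in (nd k) p \<in> nd_le k" using nth_in_mem[OF nd_subset infinite_nd[OF k]] nd_subset by blast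
    then have "((nth_in (nd k) p, f (nth_in (nd k) p)) \<^bold>\<in> F) L r'" if "L r' r" for r'
      using decided_persistent[OF d L_trans[OF that r]] by (simp add: decided_def)
    then have "(\<langle>p < n \<and> a = sorted_list_of_set (f (nth_in (nd k) p))\<rangle> \<^bold>\<and>
        (nth_in (nd k) p, f (nth_in (nd k) p)) \<^bold>\<in> F) L r'" if "L r' r" for r'
      using that p by (simp add: fAnd_def fGround_def)
    then show ?lhs
      by (intro Ex_I[where x = p] Ex_I[where x = "f (nth_in (nd k) p)"]) (use L_trans in blast)
  qed
  then have "tree_approx k n F s L q \<longleftrightarrow> (\<forall>a r. L r q \<longrightarrow> (a \<in> s \<longleftrightarrow> a \<in> set_approx k f n))"
    unfolding tree_approx_def All_Iff_iff by (simp add: fGround_def)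
  then show ?thesis using q by blast
qed

lemma decided_check:
  assumes f: "set_tree k f" and q: "L q q"
  shows "decided q (check_set ((\<lambda>j. (j, f j)) ` nd_le k)) f"
proof -
  let ?F = "check_set ((\<lambda>j. (j, f j)) ` nd_le k) :: (nat list \<times> nat set, cnd) name"
  note nd = subset_refl[of "nd_le k"] infinite_nd_le[OF k]
  have mem: "((j, w) \<^bold>\<in> ?F) L r \<longleftrightarrow> j \<in> nd_le k \<and> w = f j" if "L r r" for j w r
    using mem_check[OF that, of "(j, w)" "(\<lambda>j. (j, f j)) ` nd_le k"] by auto
  have mem': "((j, w) \<^bold>\<in> ?F) L r \<longleftrightarrow> j \<in> nd_le k \<and> w = f j" if "L r q" for j w r
    by (rule mem[OF L_refl[OF that]])
  have total: "\<exists>r. L r q' \<and> (\<exists>w. ((j, w) \<^bold>\<in> ?F) L r)" if "L r q" "j \<in> nd_le k" "L q' r" for j r q'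
    using mem'[OF L_trans[OF that(3,1)], of j "f j"] that(2) L_refl[OF that(3)] by blast
  have "E_tree k ?F L q" unfolding E_tree_iff
    using f set_tree_W_hat[OF f] unfolding set_tree_def by (auto simp: mem' intro: total)
  then show ?thesis unfolding decided_def using f mem[OF q] by blast
qed

lemma in_E_D:
  assumes "in_E k X L q" "L q q"
  shows "\<exists>r f. L r q \<and> set_tree k f \<and> (X \<^bold>= check_set (set_range k f)) L r"
proof -
  obtain r F where r: "L r q" "E_tree k F L r" "tree_range k F X L r"
    using assms unfolding in_E_def fEx_def fAnd_def by blast
  obtain r' f where r': "L r' r" "decided r' F f" using E_tree_decide[OF r(2) L_refl[OF r(1)]] by blast
  have "(X \<^bold>= check_set (set_range k f)) L r'"
    using decided_range[OF r'(2) L_refl[OF r'(1)]] persistentD[OF persistent_tree_range r(3) r'(1)] by blast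
  then show ?thesis using L_trans[OF r'(1) r(1)] r'(2) unfolding decided_def by blast
qed

lemma approx_D:
  assumes "approx k n X s L q" "L q q"
  shows "\<exists>r f. L r q \<and> set_tree k f \<and> (X \<^bold>= check_set (set_range k f)) L r \<and> s = set_approx k f n"
proof -
  obtain r F where r: "L r q" "E_tree k F L r" "tree_range k F X L r" "tree_approx k n F s L r"
    using assms unfolding approx_def fEx_def fAnd_def by blast
  obtain r' f where r': "L r' r" "decided r' F f" using E_tree_decide[OF r(2) L_refl[OF r(1)]] by blast
  have "(X \<^bold>= check_set (set_range k f)) L r'"
    using decided_range[OF r'(2) L_refl[OF r'(1)]] persistentD[OF persistent_tree_range r(3) r'(1)] by blast
  moreover have "s = set_approx k f n"
    using decided_approx[OF r'(2) L_refl[OF r'(1)]] persistentD[OF persistent_tree_approx r(4) r'(1)] by blast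
  ultimately show ?thesis using L_trans[OF r'(1) r(1)] r'(2) unfolding decided_def by blast
qed

lemma approx_I:
  assumes f: "set_tree k f" and X: "(X \<^bold>= check_set (set_range k f)) L q"
  shows "approx k n X (set_approx k f n) L q"
proof -
  let ?F = "check_set ((\<lambda>j. (j, f j)) ` nd_le k) :: (nat list \<times> nat set, cnd) name"
  have "(E_tree k ?F \<^bold>\<and> tree_range k ?F X \<^bold>\<and> tree_approx k n ?F (set_approx k f n)) L r" if "L r q" for r
  proof -
    note d = decided_check[OF f L_refl[OF that]]
    show ?thesis
      using d decided_range[OF d L_refl[OF that]] decided_approx[OF d L_refl[OF that]]
        persistentD[OF persistent_eq X that]
      by (simp add: fAnd_def decided_def)
  qed
  then show ?thesis unfolding approx_def by (rule Ex_I)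
qed

lemma in_E_I:
  assumes f: "set_tree k f" and X: "(X \<^bold>= check_set (set_range k f)) L q"
  shows "in_E k X L q"
  using approx_I[OF assms, of 0] unfolding approx_def in_E_def fEx_def fAnd_def by blast

section \<open>Approximations and end-extensions evaluated in the ground model\<close>

lemma in_AR_iff:
  assumes q: "L q q"
  shows "in_AR k s L q \<longleftrightarrow> (\<exists>f n. set_tree k f \<and> s = set_approx k f n)"
proof
  assume "in_AR k s L q"
  then obtain r1 X where r1: "L r1 q" "(\<^bold>\<exists>n. in_E k X \<^bold>\<and> approx k n X s) L r1"
    unfolding in_AR_def using Ex_D[OF _ q] by blast
  obtain r n where r: "L r r1" "approx k n X s L r"
    using Ex_D[OF r1(2) L_refl[OF r1(1)]] by (auto simp: fAnd_def)
  then show "\<exists>f n. set_tree k f \<and> s = set_approx k f n" using approx_D[OF r(2) L_refl[OF r(1)]] by blast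
next
  assume "\<exists>f n. set_tree k f \<and> s = set_approx k f n"
  then obtain f n where f: "set_tree k f" "s = set_approx k f n" by blast
  have "in_E k (check_set (set_range k f)) L r" "approx k n (check_set (set_range k f)) s L r" for r
    using in_E_I[OF f(1) eq_refl] approx_I[OF f(1) eq_refl] f(2) by auto
  then have "(in_E k (check_set (set_range k f)) \<^bold>\<and> approx k n (check_set (set_range k f)) s) L r" for r
    by (simp add: fAnd_def)
  then show "in_AR k s L q" unfolding in_AR_def
    by (intro Ex_I[where x = "check_set (set_range k f)"] Ex_I[where x = n]) blast
qed

lemma in_AR_below_iff:
  assumes q: "L q q"
  shows "in_AR_below k (check_set Y) s L q \<longleftrightarrow> (\<exists>f n. set_tree k f \<and> s = set_approx k f n) \<and> s \<subseteq> Y"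
  using in_AR_iff[OF q] q
  unfolding in_AR_below_def fAnd_def fAll_def fImp_def fGround_def by (auto simp: mem_check[OF L_refl[of _ q]])

text \<open>The two approximations of \<open>X\<close> may be witnessed by different trees. Both
  have range \<open>X\<close>, so their approximations agree and one tree serves for both.\<close>

lemma end_ext_D:
  assumes "end_ext k s t L q" and q: "L q q"
  shows "\<exists>f m n. set_tree k f \<and> m < n \<and> s = set_approx k f m \<and> t = set_approx k f n"
proof -
  obtain q1 X where q1: "L q1 q"
    "(\<^bold>\<exists>m n. in_E k X \<^bold>\<and> \<langle>m < n\<rangle> \<^bold>\<and> approx k m X s \<^bold>\<and> approx k n X t) L q1"
    using assms(1) unfolding end_ext_def using Ex_D[OF _ q] by blast
  obtain q2 m where q2: "L q2 q1"
    "(\<^bold>\<exists>n. in_E k X \<^bold>\<and> \<langle>m < n\<rangle> \<^bold>\<and> approx k m X s \<^bold>\<and> approx k n X t) L q2"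
    using Ex_D[OF q1(2) L_refl[OF q1(1)]] by blast
  obtain r n where r: "L r q2" "m < n" "approx k m X s L r" "approx k n X t L r"
    using Ex_D[OF q2(2) L_refl[OF q2(1)]] by (auto simp: fAnd_def fGround_def)
  obtain r1 f where f: "L r1 r" "set_tree k f" "(X \<^bold>= check_set (set_range k f)) L r1" "s = set_approx k f m"
    using approx_D[OF r(3) L_refl[OF r(1)]] by blast
  obtain r2 f' where f': "L r2 r1" "set_tree k f'" "(X \<^bold>= check_set (set_range k f')) L r2" "t = set_approx k f' n"
    using approx_D[OF persistentD[OF persistent_approx r(4) f(1)] L_refl[OF f(1)]] by blast
  have "(check_set (set_range k f) \<^bold>= check_set (set_range k f')) L r2"
    using eq_trans[OF eq_sym[OF persistentD[OF persistent_eq f(3) f'(1)]] f'(3)] .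
  then have "set_range k f = set_range k f'" by (rule iffD1[OF eq_check[OF L_refl[OF f'(1)]]])
  then have "t = set_approx k f n" using f'(4) set_approx_from_range[OF k f(2) f'(2)] by simp
  then show ?thesis using f(2,4) r(2) by blast
qed


section \<open>Forced membership in the values of the function\<close>

text \<open>The density form of \<in> for the value of \<open>g\<close> at \<open>A\<close>; it
  avoids fixing a name for that value.\<close>

definition forces_in :: "((nat list, cnd) name \<times> (nat, cnd) name, cnd) name \<Rightarrow> nat list set \<Rightarrow> nat \<Rightarrow> cnd \<Rightarrow> bool"
where
  "forces_in g A i q \<longleftrightarrow>
    (\<forall>q'. L q' q \<longrightarrow> (\<exists>r S. L r q' \<and> fgraph g (check_set A) S L r \<and> (i \<^bold>\<in> S) L r))"

definition forces_notin :: "((nat list, cnd) name \<times> (nat, cnd) name, cnd) name \<Rightarrow> nat list set \<Rightarrow> nat \<Rightarrow> cnd \<Rightarrow> bool"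
where
  "forces_notin g A i q \<longleftrightarrow> (\<forall>q'. L q' q \<longrightarrow> \<not> forces_in g A i q')"

lemma forces_notin_persistent: "forces_notin g A i q \<Longrightarrow> L r q \<Longrightarrow> forces_notin g A i r"
  unfolding forces_notin_def using L_trans by blast

text \<open>A failure of density yields a \<open>q'\<close> below which no condition puts
  \<open>i\<close> into the value; such a \<open>q'\<close> forces the negation.\<close>

lemma not_forces_in:
  assumes "\<not> forces_in g A i q"
  shows "\<exists>r. L r q \<and> forces_notin g A i r"
proof -
  obtain q' where q': "L q' q" "\<And>r S. L r q' \<Longrightarrow> fgraph g (check_set A) S L r \<Longrightarrow> \<not> (i \<^bold>\<in> S) L r"
    using assms unfolding forces_in_def by blast
  have "\<not> forces_in g A i q''" if q'': "L q'' q'" for q''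
  proof
    assume "forces_in g A i q''"
    then obtain r S where "L r q''" "fgraph g (check_set A) S L r" "(i \<^bold>\<in> S) L r"
      unfolding forces_in_def using L_refl[OF q''] by blast
    then show False using q'(2)[of r S] L_trans[of r q'' q'] q'' by blast
  qed
  then show ?thesis using q'(1) unfolding forces_notin_def by blast
qed

lemma monotone_iff:
  "monotone_fun D R L q \<longleftrightarrow>
    (\<forall>X S r. L r q \<longrightarrow> R X S L r \<longrightarrow> D X L r) \<and>
    (\<forall>X r. L r q \<longrightarrow> D X L r \<longrightarrow> (\<^bold>\<exists>S. R X S) L r) \<and>
    (\<forall>X S T r. L r q \<longrightarrow> R X S L r \<and> R X T L r \<longrightarrow> (S \<^bold>= T) L r) \<and>
    (\<forall>X Y S T r. L r q \<longrightarrow> R X S L r \<and> R Y T L r \<and> (X \<^bold>\<subseteq> Y) L r \<longrightarrow> (S \<^bold>\<subseteq> T) L r)"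
  unfolding monotone_fun_def fAll_def fImp_def fAnd_def by blast

lemma in_B_below_D:
  assumes X: "in_B_below k (check_set Y) X L q" and q: "L q q"
  shows "\<exists>r f. L r q \<and> set_tree k f \<and> set_range k f \<subseteq> Y \<and> L r (set_range k f) \<and>
    (X \<^bold>= check_set (set_range k f)) L r"
proof -
  have G: "in_G X L q" and E: "in_E k X L q" and sub: "(X \<^bold>\<subseteq> check_set Y) L q"
    using X by (auto simp: in_B_below_def in_B_def fAnd_def)
  obtain q1 A where q1: "L q1 q" "L q1 A" "(X \<^bold>= check_set A) L q1" using in_G_D[OF G q] by blast
  obtain r f where r: "L r q1" "set_tree k f" "(X \<^bold>= check_set (set_range k f)) L r"
    using in_E_D[OF persistentD[OF persistent_in_E E q1(1)] L_refl[OF q1(1)]] by blast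
  have "(check_set A \<^bold>= check_set (set_range k f)) L r"
    using eq_trans[OF eq_sym[OF persistentD[OF persistent_eq q1(3) r(1)]] r(3)] .
  then have A: "A = set_range k f" by (rule iffD1[OF eq_check[OF L_refl[OF r(1)]]])
  have "a \<in> Y" if "a \<in> set_range k f" for a
  proof -
    have "(a \<^bold>\<in> X) L r" using eq_check_mem[OF r(3) L_refl[OF r(1)]] that by simp
    then have "(a \<^bold>\<in> check_set Y) L r" using sub L_trans[OF r(1) q1(1)] unfolding subset_iff by blast
    then show ?thesis using mem_check[OF L_refl[OF r(1)], of a Y] by simp
  qed
  then show ?thesis using r A L_trans[OF r(1) q1(1)] L_trans[OF r(1) q1(2)] by blast
qed

lemma set_range_Wrange: "set_tree k f \<Longrightarrow> set_range k f \<subseteq> Wrange k"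
  unfolding set_range_def by (rule set_tree_range[OF k])

text \<open>The range is positive and hence contains elements with arbitrarily large first entry. So
  every \<open>i\<close> eventually falls below the bound that limits \<open>ghat\<close>.\<close>

lemma set_approx_unbounded:
  assumes f: "set_tree k f"
  shows "\<exists>n. \<exists>x\<in>entries (set_approx k f n). i \<le> x"
proof -
  let ?F = "\<lambda>j. sorted_list_of_set (f j)"
  obtain k' where k': "k = Suc k'" using k by (cases k) auto
  have "positive (Suc k') (?F ` nd k)" using list_tree_range_positive[OF set_tree_list_tree[OF k f]] k' by simp
  then have "positive (Suc k') {u \<in> ?F ` nd k. u \<noteq> [] \<and> i < hd u}" by (rule positive_tail)
  then obtain u where u: "u \<in> ?F ` nd k" "u \<noteq> []" "i < hd u"
    using positive_nonempty[of "Suc k'" "{u \<in> ?F ` nd k. u \<noteq> [] \<and> i < hd u}"] by auto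
  then obtain j where j: "j \<in> nd k" "u = ?F j" by auto
  have "u \<in> set_approx k f (Suc (index_in (nd k) j))"
    unfolding set_approx_def list_approx_def using j by (intro image_eqI[of _ _ j]) auto
  moreover have "hd u \<in> set u" using u by simp
  ultimately have "hd u \<in> entries (set_approx k f (Suc (index_in (nd k) j)))" unfolding entries_def by blast
  then show ?thesis using u(3) less_imp_le by blast
qed

lemma finite_entries: "finite s \<Longrightarrow> finite (entries s)"
  by (simp add: entries_def)

section \<open>Values of a function that is forced to be monotone\<close>

context
  fixes g :: "((nat list, cnd) name \<times> (nat, cnd) name, cnd) name" and p :: cnd
  assumes mon: "monotone_fun in_G (fgraph g) L p"
begin

lemma g_total:
  assumes "L q p" "in_G X L q"
  shows "\<exists>r S. L r q \<and> fgraph g X S L r"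
proof (rule Ex_D)
  show "(\<^bold>\<exists>S. fgraph g X S) L q" using mon assms unfolding monotone_iff by blast
  show "L q q" by (rule L_refl[OF assms(1)])
qed

lemma g_unique: "L q p \<Longrightarrow> fgraph g X S L q \<Longrightarrow> fgraph g X T L q \<Longrightarrow> (S \<^bold>= T) L q"
  using mon unfolding monotone_iff by blast

lemma g_mono:
  "L q p \<Longrightarrow> fgraph g X S L q \<Longrightarrow> fgraph g Y T L q \<Longrightarrow> (X \<^bold>\<subseteq> Y) L q \<Longrightarrow> (S \<^bold>\<subseteq> T) L q"
  using mon unfolding monotone_iff by blast

text \<open>A condition below \<open>A\<close> puts both \<open>A\<close> and \<open>B\<close> into
  the generic. Some stronger condition gives a value at \<open>B\<close>, and monotonicity puts the
  value at \<open>A\<close> inside it.\<close>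

lemma forces_in_subset:
  assumes q: "L q p" "L q A" and AB: "A \<subseteq> B" "B \<subseteq> tuples k" and g: "forces_in g A i q"
  shows "forces_in g B i q"
  unfolding forces_in_def
proof (intro allI impI)
  fix q' assume q': "L q' q"
  then obtain r S where r: "L r q'" "fgraph g (check_set A) S L r" "(i \<^bold>\<in> S) L r"
    using g unfolding forces_in_def by blast
  have rq: "L r q" using L_trans[OF r(1) q'] .
  have "positive k A" using Fin_le_refl2[OF q(2) k] by (simp add: Fin_le_iff[OF k])
  then have "L A B" using Fin_le_subset[OF k _ AB] by simp
  then have "L r B" using L_trans[OF L_trans[OF rq q(2)]] by blast
  then obtain r' T where r': "L r' r" "fgraph g (check_set B) T L r'"
    using g_total[OF L_trans[OF rq q(1)] in_G_check] by blast
  have r'p: "L r' p" using L_trans[OF r'(1) L_trans[OF rq q(1)]] .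
  have "(check_set A \<^bold>\<subseteq> check_set B) L r'"
    unfolding subset_iff using AB(1) by (auto simp: mem_check[OF L_refl[of _ r']])
  then have "(S \<^bold>\<subseteq> T) L r'" using g_mono[OF r'p persistentD[OF persistent_graph r(2) r'(1)] r'(2)] by blast
  then have "(i \<^bold>\<in> T) L r'"
    unfolding subset_iff using persistentD[OF persistent_in_set r(3) r'(1)] L_refl[OF r'(1)] by blast
  then show "\<exists>r S. L r q' \<and> fgraph g (check_set B) S L r \<and> (i \<^bold>\<in> S) L r"
    using r'(2) L_trans[OF r'(1) r(1)] by blast
qed

lemma forces_notin_subset:
  assumes q: "L q p" "L q A" and AB: "A \<subseteq> B" "B \<subseteq> tuples k" and g: "forces_notin g B i q"
  shows "forces_notin g A i q"
  unfolding forces_notin_def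
proof (intro allI impI notI)
  fix q' assume q': "L q' q" and "forces_in g A i q'"
  then have "forces_in g B i q'"
    using forces_in_subset[OF L_trans[OF q' q(1)] L_trans[OF q' q(2)] AB] by blast
  then show False using g q' unfolding forces_notin_def by blast
qed

text \<open>Names of the value at \<open>A\<close> may differ from one condition to another, but
  they are forced equal.\<close>

lemma g_value:
  assumes q: "L q p" and g: "fgraph g X S L q" and X: "(X \<^bold>= check_set A) L q"
  shows "(i \<^bold>\<in> S) L q \<longleftrightarrow> forces_in g A i q"
proof
  have gA: "fgraph g (check_set A) S L q" by (rule graph_cong[OF g X eq_refl])
  {
    assume i: "(i \<^bold>\<in> S) L q"
    show "forces_in g A i q" unfolding forces_in_def
    proof (intro allI impI)
      fix q' assume q': "L q' q"
      then show "\<exists>r S. L r q' \<and> fgraph g (check_set A) S L r \<and> (i \<^bold>\<in> S) L r"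
        using L_refl[OF q'] persistentD[OF persistent_graph gA q'] persistentD[OF persistent_in_set i q']
        by blast
    qed
  next
    assume forces_in: "forces_in g A i q"
    show "(i \<^bold>\<in> S) L q"
    proof (rule mem_local)
      fix q' assume q': "L q' q"
      then obtain r T where r: "L r q'" "fgraph g (check_set A) T L r" "(i \<^bold>\<in> T) L r"
        using forces_in unfolding forces_in_def by blast
      have rq: "L r q" using L_trans[OF r(1) q'] .
      have "(S \<^bold>= T) L r"
        using g_unique[OF L_trans[OF rq q] persistentD[OF persistent_graph gA rq] r(2)] .
      then show "\<exists>r. L r q' \<and> (i \<^bold>\<in> S) L r"
        using r(1,3) L_refl[OF r(1)] unfolding eq_iff by blast
    qed
  }
qed

text \<open>\<open>C\<close> acts both as the argument of \<open>g\<close> and as the condition.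
  Being below \<open>p\<close>, it forces that \<open>g\<close> is monotone.\<close>

definition omits :: "nat list set \<Rightarrow> nat \<Rightarrow> bool" where
  "omits C i \<longleftrightarrow> L C p \<and> forces_notin g C i C"

text \<open>Passing to \<open>B\<close> strengthens the condition, which keeps the negation, and
  shrinks the argument, which by monotonicity can only shrink the value.\<close>

lemma omits_antimono:
  assumes C: "omits C i" and B: "B \<subseteq> C" "positive k B"
  shows "omits B i"
proof -
  have Cp: "L C p" and Cg: "forces_notin g C i C" using C by (auto simp: omits_def)
  have Ct: "C \<subseteq> tuples k" using Cp by (simp add: Fin_le_iff[OF k])
  have BC: "L B C" by (rule Fin_le_subset[OF k B(2,1) Ct])
  have "forces_notin g B i B"
    using forces_notin_subset[OF L_trans[OF BC Cp] L_refl[OF BC] B(1) Ct forces_notin_persistent[OF Cg BC]] .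
  then show ?thesis using L_trans[OF BC Cp] by (simp add: omits_def)
qed

section \<open>Finite approximations of the function below a fused set\<close>

context
  fixes F :: "nat list \<Rightarrow> nat list" and Y :: cnd
  assumes F: "list_tree k F" and Y: "Y = F ` nd k" and Yp: "L Y p"
    and dec: "\<And>s i x. finite s \<Longrightarrow> s \<subseteq> Y \<Longrightarrow> x \<in> entries s \<Longrightarrow> i \<le> x \<Longrightarrow> decides k omits Y s i"
begin

lemma Y_tuples: "Y \<subseteq> tuples k"
  unfolding Y by (rule list_tree_range_tuples[OF F])

lemma continuation_tuples: "s \<subseteq> Y \<Longrightarrow> continuation Y s \<subseteq> tuples k"
  using Y_tuples by (auto simp: continuation_def)

lemma branching_I:
  assumes "v \<in> Y" "q < k" "q = 0 \<or> (\<exists>u\<in>s. take q u = take q v)"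
    "Max (insert 0 (entries t)) < v ! q" "finite t" "s \<subseteq> t"
  shows "v \<in> branching t \<and> v \<in> branching s"
proof -
  have "length v = k" using assms(1) Y_tuples by (auto simp: tuples_def)
  moreover have "x < v ! q" if "x \<in> entries t" for x
  proof -
    have "x \<le> Max (insert 0 (entries t))" using that finite_entries[OF assms(5)] by simp
    then show ?thesis using assms(4) by simp
  qed
  moreover have "entries s \<subseteq> entries t" using assms(6) by (auto simp: entries_def)
  ultimately show ?thesis using assms(2,3,6) unfolding branching_def by blast
qed

text \<open>Above a node of \<open>s\<close>, an element of \<open>Y\<close> whose next entry
  exceeds all entries of \<open>t\<close> branches off from \<open>s\<close> and from
  \<open>t\<close> alike, so \<open>full_overI\<close> applies to the intersection.\<close>

lemma continuation_Int_big:
  assumes "finite t" "s \<subseteq> t" "t \<subseteq> Y"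
  shows "full_over k (continuation Y s \<inter> continuation Y t) s"
proof (rule full_overI[OF F k, where b = "Max (insert 0 (entries t))"])
  show "s \<subseteq> continuation Y s \<inter> continuation Y t" using assms by (auto simp: continuation_def)
  show "s \<subseteq> F ` nd k" using assms Y by auto
  fix v q assume "v \<in> F ` nd k" "q < k" "q = 0 \<or> (\<exists>u\<in>s. take q u = take q v)"
    "Max (insert 0 (entries t)) < v ! q"
  then show "v \<in> continuation Y s \<inter> continuation Y t"
    using branching_I[of v q s t] assms Y by (auto simp: continuation_def)
qed

lemma continuation_positive: "finite s \<Longrightarrow> s \<subseteq> Y \<Longrightarrow> positive k (continuation Y s)"
  using continuation_Int_big[of s s] by (simp add: full_over_def)

text \<open>The given \<open>C\<close> refutes the second alternative of \<open>decides\<close>, so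
  a superset of the continuation omits \<open>i\<close>; omission passes down to the continuation
  since that is positive.\<close>

lemma omits_continuation:
  assumes "finite s" "s \<subseteq> Y" "\<exists>x\<in>entries s. i \<le> x"
    and "s \<subseteq> C" "C \<subseteq> continuation Y s" "full_over k C s" "omits C i"
  shows "omits (continuation Y s) i"
proof -
  have "decides k omits Y s i" using dec assms(1-3) by blast
  then obtain C where "continuation Y s \<subseteq> C" "omits C i"
    using assms(4-7) unfolding decides_def by blast
  then show ?thesis using omits_antimono continuation_positive[OF assms(1,2)] by blast
qed

text \<open>The bound by an entry of \<open>s\<close> makes the value finite and keeps
  \<open>i\<close> in the range for which the fusion has decided \<open>s\<close>.\<close>

definition ghat :: "nat list set \<Rightarrow> nat set" where
  "ghat s = {i. (\<exists>x\<in>entries s. i \<le> x) \<and> \<not> omits (continuation Y s) i}"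

lemma finite_ghat:
  assumes "finite s" shows "finite (ghat s)"
proof (rule finite_subset)
  show "ghat s \<subseteq> (\<Union>x\<in>entries s. {..x})" by (auto simp: ghat_def)
qed (simp add: finite_entries[OF assms])

text \<open>If the continuation of \<open>t\<close> omitted \<open>i\<close>, so would its
  intersection with the continuation of \<open>s\<close>. That intersection is full over
  \<open>s\<close>, hence the continuation of \<open>s\<close> would omit \<open>i\<close> as
  well.\<close>

lemma ghat_mono:
  assumes "finite t" "s \<subseteq> t" "t \<subseteq> Y"
  shows "ghat s \<subseteq> ghat t"
proof
  fix i assume i: "i \<in> ghat s"
  have s: "finite s" "s \<subseteq> Y" using assms finite_subset by auto
  have "\<not> omits (continuation Y t) i"
  proof
    assume Nt: "omits (continuation Y t) i"
    let ?C = "continuation Y s \<inter> continuation Y t"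
    have big: "full_over k ?C s" by (rule continuation_Int_big[OF assms])
    have "omits ?C i" by (rule omits_antimono[OF Nt]) (use big in \<open>auto simp: full_over_def\<close>)
    then have "omits (continuation Y s) i"
      using omits_continuation[OF s _ _ _ big] i assms by (auto simp: ghat_def continuation_def)
    then show False using i by (simp add: ghat_def)
  qed
  moreover have "entries s \<subseteq> entries t" using assms by (auto simp: entries_def)
  ultimately show "i \<in> ghat t" using i by (auto simp: ghat_def)
qed

lemma finite_set_approx: "finite (set_approx k f n)"
  unfolding set_approx_def by (rule finite_list_approx[OF k])

text \<open>An end-extension branches off from \<open>s\<close>, so its continuation is contained in
  that of \<open>s\<close> and omits at least as much. A number of the larger value below an element
  of the smaller one is then not omitted over \<open>s\<close>, and it respects the bound.\<close>

lemma ghat_init_seg: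
  assumes f: "set_tree k f" and mn: "m < n" and t: "set_approx k f n \<subseteq> Y"
  shows "init_seg (ghat (set_approx k f m)) (ghat (set_approx k f n))"
proof -
  let ?s = "set_approx k f m" and ?t = "set_approx k f n"
  note T = set_tree_list_tree[OF k f]
  have st: "?s \<subseteq> ?t" using mn by (auto simp: set_approx_def list_approx_def)
  have ext: "?t \<subseteq> ?s \<union> branching ?s"
    using list_tree_range_branching[OF T k, of _ m] list_approx_subset[of k _ n] unfolding set_approx_def by blast
  have sub: "continuation Y ?t \<subseteq> continuation Y ?s"
    using branching_trans[OF st ext] ext t unfolding continuation_def by blast
  show ?thesis unfolding init_seg_def
  proof (intro conjI ballI impI)
    show "ghat ?s \<subseteq> ghat ?t" by (rule ghat_mono[OF finite_set_approx st t])
    fix x y assume xy: "x \<in> ghat ?s" "y \<in> ghat ?t" "y < x"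
    have "\<not> omits (continuation Y ?s) y"
      using omits_antimono[OF _ sub continuation_positive[OF finite_set_approx t]] xy(2) by (auto simp: ghat_def)
    moreover obtain z where "z \<in> entries ?s" "x \<le> z" using xy(1) by (auto simp: ghat_def)
    then have "\<exists>z\<in>entries ?s. y \<le> z" using xy(3) by (intro bexI[of _ z]) auto
    ultimately show "y \<in> ghat ?s" by (simp add: ghat_def)
  qed
qed

lemma set_range_continuation:
  assumes f: "set_tree k f" and V: "set_range k f \<subseteq> Y"
  shows "set_range k f \<subseteq> continuation Y (set_approx k f n)" "set_approx k f n \<subseteq> Y"
  using list_tree_range_branching[OF set_tree_list_tree[OF k f] k, of _ n] list_approx_subset[of k "\<lambda>j. sorted_list_of_set (f j)" n] V
  unfolding set_range_def set_approx_def continuation_def by blast+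

text \<open>The member of the space lies inside the continuation of its approximation. By
  monotonicity \<open>q\<close> forces \<open>i\<close> into the value there, and \<open>q\<close>
  is below that continuation, which therefore cannot omit \<open>i\<close>.\<close>

lemma ghat_forward:
  assumes f: "set_tree k f" and V: "set_range k f \<subseteq> Y" and q: "L q p" "L q (set_range k f)"
    and forces_in: "forces_in g (set_range k f) i q" and i: "\<exists>x\<in>entries (set_approx k f n). i \<le> x"
  shows "i \<in> ghat (set_approx k f n)"
proof -
  let ?s = "set_approx k f n" and ?V = "set_range k f"
  note VY = set_range_continuation[OF f V, of n]
  have "\<not> omits (continuation Y ?s) i"
  proof
    assume "omits (continuation Y ?s) i"
    then have *: "forces_notin g (continuation Y ?s) i (continuation Y ?s)" by (simp add: omits_def)
    have "positive k ?V" using Fin_le_refl2[OF q(2) k] by (simp add: Fin_le_iff[OF k])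
    then have "L q (continuation Y ?s)"
      using L_trans[OF q(2)] Fin_le_subset[OF k _ VY(1) continuation_tuples[OF VY(2)]] by blast
    from forces_notin_persistent[OF * this] have "\<not> forces_in g (continuation Y ?s) i q"
      unfolding forces_notin_def using L_refl[OF q(1)] by blast
    moreover have "forces_in g (continuation Y ?s) i q"
      by (rule forces_in_subset[OF q VY(1) continuation_tuples[OF VY(2)] forces_in])
    ultimately show False by blast
  qed
  then show ?thesis using i by (simp add: ghat_def)
qed

text \<open>A counterexample \<open>r\<close> is turned into a set \<open>C\<close> that omits
  \<open>i\<close> and is full over the approximation, against \<open>omits_continuation\<close>. At
  the root fullness is positivity of \<open>C\<close>; above the other nodes \<open>C\<close> and
  \<open>?V\<close> have the same fibers.\<close>

lemma ghat_backward:
  assumes f: "set_tree k f" and V: "set_range k f \<subseteq> Y" and q: "L q p" "L q (set_range k f)"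
    and i: "i \<in> ghat (set_approx k f n)"
  shows "forces_in g (set_range k f) i q"
proof (rule ccontr)
  let ?s = "set_approx k f n" and ?V = "set_range k f"
  note VY = set_range_continuation[OF f V, of n] and T = set_tree_list_tree[OF k f]
  have Vt: "?V \<subseteq> tuples k" using V Y_tuples by auto
  have sV: "?s \<subseteq> ?V" unfolding set_approx_def set_range_def by (rule list_approx_subset)
  assume "\<not> forces_in g ?V i q"
  then obtain r where r: "L r q" "forces_notin g ?V i r" using not_forces_in by blast
  \<comment> \<open>restore the columns of \<open>V\<close> that meet \<open>s\<close>; they are negligible, so \<open>C\<close> and \<open>r\<close> are equivalent\<close>
  define D where "D = {v \<in> ?V. \<exists>x\<in>entries ?s. hd v \<le> x}"
  define C where "C = r \<inter> ?V \<union> D"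
  have rV: "L r ?V" using L_trans[OF r(1) q(2)] .
  have rt: "r \<subseteq> tuples k" using r(1) by (simp add: Fin_le_iff[OF k])
  have CV: "C \<subseteq> ?V" by (auto simp: C_def D_def)
  have Cpos: "positive k C" using Fin_le_positive_Int[OF k rV] by (rule positive_mono) (auto simp: C_def)
  have "\<not> positive k (C - r)"
  proof (rule not_positive_first_bounded[OF k])
    fix v assume "v \<in> C - r"
    then obtain x where "x \<in> entries ?s" "hd v \<le> x" by (auto simp: C_def D_def)
    moreover have "x \<le> Max (entries ?s)" using calculation finite_entries[OF finite_set_approx] by simp
    ultimately show "hd v \<le> Max (entries ?s)" by simp
  qed
  then have Cr: "L C r" using Cpos CV Vt rt by (auto simp: Fin_le_iff[OF k])
  have Cp: "L C p" using L_trans[OF Cr L_trans[OF r(1) q(1)]] .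
  have "forces_notin g C i C"
    using forces_notin_subset[OF Cp L_refl[OF Cp] CV Vt forces_notin_persistent[OF r(2) Cr]] .
  then have NC: "omits C i" using Cp by (simp add: omits_def)
  \<comment> \<open>Sharing a nonempty initial segment with a member of \<open>?s\<close> means
    sharing its first entry, so every such element of \<open>?V\<close> lies in a restored
    column.\<close>
  have hd: "\<exists>x\<in>entries ?s. hd v \<le> x" if u: "u \<in> ?s" and v: "take q u = take q v" "0 < q" for u v q
  proof -
    have "u \<noteq> []" using u sV Vt k by (auto simp: tuples_def)
    moreover have "hd v = hd u" using v by (metis hd_take)
    moreover have "hd u \<in> entries ?s" using calculation u hd_in_set unfolding entries_def by blast
    ultimately show ?thesis by auto
  qed
  have sC: "?s \<subseteq> C"
  proof
    fix u assume u: "u \<in> ?s"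
    show "u \<in> C" using hd[OF u refl, of 1] u sV by (auto simp: C_def D_def)
  qed
  have "full_over k C ?s" unfolding full_over_def
  proof (intro conjI ballI allI impI)
    show "positive k C" by (rule Cpos)
    fix u m assume u: "u \<in> ?s" and m: "m \<le> k"
    show "positive (k - m) (fiber C (take m u))"
    proof (cases "m = 0")
      case True then show ?thesis using Cpos by simp
    next
      case False
      obtain j where j: "j \<in> nd k" "u = sorted_list_of_set (f j)" using u by (auto simp: set_approx_def list_approx_def)
      then have jn: "j \<in> nd_le k" "length j = k" using nd_subset by (auto simp: nd_def)
      have "positive (k - length (take m j)) (fiber ?V (sorted_list_of_set (f (take m j))))"
        unfolding set_range_def by (rule list_tree_positive[OF T take_nd_le[OF jn(1)]])
      moreover have "length (take m j) = m" using jn m by simp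
      moreover have "sorted_list_of_set (f (take m j)) = take m u"
        using list_tree_take[OF T jn(1)] j by simp
      ultimately have "positive (k - m) (fiber ?V (take m u))" by simp
      moreover have "fiber ?V (take m u) \<subseteq> fiber C (take m u)"
      proof
        fix w assume w: "w \<in> fiber ?V (take m u)"
        have "length u = k" using u sV Vt by (auto simp: tuples_def)
        then have "take m u = take m (take m u @ w)" using m by simp
        from hd[OF u this] show "w \<in> fiber C (take m u)"
          using w False by (auto simp: fiber_def C_def D_def)
      qed
      ultimately show ?thesis by (rule positive_mono)
    qed
  qed
  moreover have "C \<subseteq> continuation Y ?s" using CV VY(1) by blast
  moreover have "\<exists>x\<in>entries ?s. i \<le> x" "\<not> omits (continuation Y ?s) i" using i by (auto simp: ghat_def)
  ultimately show False using omits_continuation[OF finite_set_approx VY(2) _ sC _ _ NC] by blast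
qed


text \<open>The witness is the check name of the graph of \<open>ghat\<close> on the approximations
  inside \<open>Y\<close>, a ground model set. Monotonicity is inherited from \<open>g\<close>, and
  the union formula combines \<open>ghat_forward\<close> with \<open>ghat_backward\<close> after
  deciding the argument.\<close>

lemma basic_fusion:
  shows "basic k (check_set Y) (restrict_graph (in_B_below k (check_set Y)) (fgraph g)) L Y"
proof -
  let ?Y = "check_set Y :: (nat list, cnd) name"
  let ?R = "restrict_graph (in_B_below k ?Y) (fgraph g)"
  define AR where "AR = {s. (\<exists>f n. set_tree k f \<and> s = set_approx k f n) \<and> s \<subseteq> Y}"
  define h :: "(nat list set \<times> nat set, cnd) name" where "h = check_set ((\<lambda>s. (s, ghat s)) ` AR)"
  have h: "((s, u) \<^bold>\<in> h) L q \<longleftrightarrow> s \<in> AR \<and> u = ghat s" if "L q q" for s u q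
    unfolding h_def using mem_check[OF that, of "(s, u)" "(\<lambda>s. (s, ghat s)) ` AR"] by auto
  have AR: "in_AR_below k ?Y s L q \<longleftrightarrow> s \<in> AR" if "L q q" for s q
    unfolding AR_def using in_AR_below_iff[OF that, of Y s] by simp
  have AR_D: "finite s" "s \<subseteq> Y" if "s \<in> AR" for s
    using that finite_set_approx unfolding AR_def by auto
  have R: "?R X S L q \<longleftrightarrow> in_B_below k ?Y X L q \<and> fgraph g X S L q" for X S q
    by (simp add: restrict_graph_def fAnd_def)
  have "monotone_fun (in_B_below k ?Y) ?R L Y" unfolding monotone_iff R
  proof (intro conjI allI impI)
    fix X r assume r: "L r Y" and X: "in_B_below k ?Y X L r"
    then have "in_G X L r" by (simp add: in_B_below_def in_B_def fAnd_def)
    show "(\<^bold>\<exists>S. ?R X S) L r" unfolding fEx_def R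
    proof (intro allI impI)
      fix q assume q: "L q r"
      obtain q' S where q': "L q' q" "fgraph g X S L q'"
        using g_total[OF L_trans[OF q L_trans[OF r Yp]] persistentD[OF persistent_in_G \<open>in_G X L r\<close> q]]
        by blast
      then show "\<exists>q'. L q' q \<and> (\<exists>S. in_B_below k ?Y X L q' \<and> fgraph g X S L q')"
        using persistentD[OF persistent_in_B_below X L_trans[OF q'(1) q]] by blast
    qed
  next
    fix X S T r assume "L r Y"
      "(in_B_below k ?Y X L r \<and> fgraph g X S L r) \<and> in_B_below k ?Y X L r \<and> fgraph g X T L r"
    then show "(S \<^bold>= T) L r" using g_unique[OF L_trans[OF _ Yp]] by blast
  next
    fix X X' S T r assume "L r Y"
      "(in_B_below k ?Y X L r \<and> fgraph g X S L r) \<and>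
       (in_B_below k ?Y X' L r \<and> fgraph g X' T L r) \<and> (X \<^bold>\<subseteq> X') L r"
    then show "(S \<^bold>\<subseteq> T) L r" using g_mono[OF L_trans[OF _ Yp]] by blast
  qed blast
  moreover have value_iff: "(i \<^bold>\<in> S) L r \<longleftrightarrow>
      (\<^bold>\<exists>n s u. approx k n X s \<^bold>\<and> (s, u) \<^bold>\<in> h \<^bold>\<and> \<langle>i \<in> u\<rangle>) L r"
    if r: "L r Y" and X: "in_B_below k ?Y X L r" and S: "fgraph g X S L r" for X S r i
  proof
    assume i: "(i \<^bold>\<in> S) L r"
    show "(\<^bold>\<exists>n s u. approx k n X s \<^bold>\<and> (s, u) \<^bold>\<in> h \<^bold>\<and> \<langle>i \<in> u\<rangle>) L r"
      unfolding fEx_def[of "\<lambda>n. \<^bold>\<exists>s u. approx k n X s \<^bold>\<and> (s, u) \<^bold>\<in> h \<^bold>\<and> \<langle>i \<in> u\<rangle>"]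
    proof (intro allI impI)
      fix q assume q: "L q r"
      obtain q' f where q': "L q' q" and f: "set_tree k f" "set_range k f \<subseteq> Y" "L q' (set_range k f)"
        "(X \<^bold>= check_set (set_range k f)) L q'"
        using in_B_below_D[OF persistentD[OF persistent_in_B_below X q] L_refl[OF q]] by blast
      have q'r: "L q' r" by (rule L_trans[OF q' q])
      have q'p: "L q' p" by (rule L_trans[OF q'r L_trans[OF r Yp]])
      \<comment> \<open>The approximation is taken so long that \<open>i\<close> is within its
        bound.\<close>
      obtain n where n: "\<exists>x\<in>entries (set_approx k f n). i \<le> x" using set_approx_unbounded[OF f(1)] by blast
      have "forces_in g (set_range k f) i q'"
        using g_value[OF q'p persistentD[OF persistent_graph S q'r] f(4)]
          persistentD[OF persistent_in_set i q'r] by blast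
      then have ig: "i \<in> ghat (set_approx k f n)" by (rule ghat_forward[OF f(1,2) q'p f(3) _ n])
      have s: "set_approx k f n \<in> AR" unfolding AR_def using f(1) set_range_continuation(2)[OF f(1,2)] by blast
      have "(\<^bold>\<exists>s u. approx k n X s \<^bold>\<and> (s, u) \<^bold>\<in> h \<^bold>\<and> \<langle>i \<in> u\<rangle>) L q'"
      proof (rule Ex_I[where x = "set_approx k f n"], rule Ex_I[where x = "ghat (set_approx k f n)"])
        fix q1 q2 assume q12: "L q1 q'" "L q2 q1"
        have "L q2 q'" by (rule L_trans[OF q12(2,1)])
        then show "(approx k n X (set_approx k f n) \<^bold>\<and> (set_approx k f n, ghat (set_approx k f n)) \<^bold>\<in> h \<^bold>\<and>
            \<langle>i \<in> ghat (set_approx k f n)\<rangle>) L q2"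
          using persistentD[OF persistent_approx approx_I[OF f(1,4)]] h[OF L_refl[OF q12(2)]] s ig
          by (simp add: fAnd_def fGround_def)
      qed
      then show "\<exists>r. L r q \<and> (\<exists>n. (\<^bold>\<exists>s u. approx k n X s \<^bold>\<and> (s, u) \<^bold>\<in> h \<^bold>\<and> \<langle>i \<in> u\<rangle>) L r)"
        using q' by blast
    qed
  next
    assume ex: "(\<^bold>\<exists>n s u. approx k n X s \<^bold>\<and> (s, u) \<^bold>\<in> h \<^bold>\<and> \<langle>i \<in> u\<rangle>) L r"
    show "(i \<^bold>\<in> S) L r"
    proof (rule mem_local)
      fix q assume q: "L q r"
      obtain q1 n where q1: "L q1 q" "(\<^bold>\<exists>s u. approx k n X s \<^bold>\<and> (s, u) \<^bold>\<in> h \<^bold>\<and> \<langle>i \<in> u\<rangle>) L q1"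
        using Ex_D[OF persistentD[OF persistent_Ex ex q] L_refl[OF q]] by blast
      obtain q2 s where q2: "L q2 q1" "(\<^bold>\<exists>u. approx k n X s \<^bold>\<and> (s, u) \<^bold>\<in> h \<^bold>\<and> \<langle>i \<in> u\<rangle>) L q2"
        using Ex_D[OF q1(2) L_refl[OF q1(1)]] by blast
      obtain q3 u where q3: "L q3 q2" "approx k n X s L q3" "((s, u) \<^bold>\<in> h) L q3" "i \<in> u"
        using Ex_D[OF q2(2) L_refl[OF q2(1)]] by (auto simp: fAnd_def fGround_def)
      have u: "u = ghat s" using h[OF L_refl[OF q3(1)]] q3(3) by simp
      have q3r: "L q3 r" by (rule L_trans[OF q3(1) L_trans[OF q2(1) L_trans[OF q1(1) q]]])
      obtain q4 f where q4: "L q4 q3" and f: "set_tree k f" "set_range k f \<subseteq> Y" "L q4 (set_range k f)"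
        "(X \<^bold>= check_set (set_range k f)) L q4"
        using in_B_below_D[OF persistentD[OF persistent_in_B_below X q3r] L_refl[OF q3(1)]] by blast
      \<comment> \<open>The tree witnessing the approximation need not be the \<open>f\<close>
        decided before; equality of their ranges identifies the approximations.\<close>
      obtain q5 f' where q5: "L q5 q4" and f': "set_tree k f'" "(X \<^bold>= check_set (set_range k f')) L q5"
        "s = set_approx k f' n"
        using approx_D[OF persistentD[OF persistent_approx q3(2) q4] L_refl[OF q4]] by blast
      have "(check_set (set_range k f) \<^bold>= check_set (set_range k f')) L q5"
        by (rule eq_trans[OF eq_sym[OF persistentD[OF persistent_eq f(4) q5]] f'(2)])
      then have "set_range k f = set_range k f'" by (rule iffD1[OF eq_check[OF L_refl[OF q5]]])
      then have s: "s = set_approx k f n" using f'(3) set_approx_from_range[OF k f(1) f'(1)] by simp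
      have q4r: "L q4 r" by (rule L_trans[OF q4 q3r])
      have q4p: "L q4 p" by (rule L_trans[OF q4r L_trans[OF r Yp]])
      have "forces_in g (set_range k f) i q4"
        using ghat_backward[OF f(1,2) q4p f(3)] q3(4) unfolding u s by blast
      then have "(i \<^bold>\<in> S) L q4"
        using g_value[OF q4p persistentD[OF persistent_graph S q4r] f(4)] by blast
      then show "\<exists>r. L r q \<and> (i \<^bold>\<in> S) L r"
        using L_trans[OF q4 L_trans[OF q3(1) L_trans[OF q2(1) q1(1)]]] by blast
    qed
  qed
  ultimately show ?thesis
    unfolding basic_def fAnd_def[of "monotone_fun _ _"]
  proof (intro conjI)
    show "(\<^bold>\<exists>h :: (nat list set \<times> nat set, cnd) name.
       (\<^bold>\<forall>s u. (s, u) \<^bold>\<in> h \<^bold>\<longrightarrow> in_AR_below k ?Y s \<^bold>\<and> \<langle>finite u\<rangle>) \<^bold>\<and>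
       (\<^bold>\<forall>s. in_AR_below k ?Y s \<^bold>\<longrightarrow> (\<^bold>\<exists>u. (s, u) \<^bold>\<in> h)) \<^bold>\<and>
       (\<^bold>\<forall>s u v. (s, u) \<^bold>\<in> h \<^bold>\<and> (s, v) \<^bold>\<in> h \<^bold>\<longrightarrow> \<langle>u = v\<rangle>) \<^bold>\<and>
       (\<^bold>\<forall>s t u v. (s, u) \<^bold>\<in> h \<^bold>\<and> (t, v) \<^bold>\<in> h \<^bold>\<and> \<langle>s \<subseteq> t\<rangle> \<^bold>\<longrightarrow> \<langle>u \<subseteq> v\<rangle>) \<^bold>\<and>
       (\<^bold>\<forall>s t u v. (s, u) \<^bold>\<in> h \<^bold>\<and> (t, v) \<^bold>\<in> h \<^bold>\<and> end_ext k s t \<^bold>\<longrightarrow> \<langle>init_seg u v\<rangle>) \<^bold>\<and>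
       (\<^bold>\<forall>X S. ?R X S \<^bold>\<longrightarrow>
         (\<^bold>\<forall>i. i \<^bold>\<in> S \<^bold>\<longleftrightarrow>
           (\<^bold>\<exists>n s u. approx k n X s \<^bold>\<and> (s, u) \<^bold>\<in> h \<^bold>\<and> \<langle>i \<in> u\<rangle>)))) L Y"
    proof (rule Ex_I[where x = h])
      fix r assume r: "L r Y"
      have h': "((s, u) \<^bold>\<in> h) L q \<longleftrightarrow> s \<in> AR \<and> u = ghat s" if "L q r" for s u q
        by (rule h[OF L_refl[OF that]])
      have c1: "(\<^bold>\<forall>s u. (s, u) \<^bold>\<in> h \<^bold>\<longrightarrow> in_AR_below k ?Y s \<^bold>\<and> \<langle>finite u\<rangle>) L r"
        unfolding fAll_def fImp_def fAnd_def fGround_def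
        using h' AR[OF L_refl[of _ r]] finite_ghat AR_D(1) by simp
      have c2: "(\<^bold>\<forall>s. in_AR_below k ?Y s \<^bold>\<longrightarrow> (\<^bold>\<exists>u. (s, u) \<^bold>\<in> h)) L r"
        unfolding fAll_def fImp_def
      proof (intro allI impI)
        fix s q assume q: "L q r" and "in_AR_below k ?Y s L q"
        then have "s \<in> AR" using AR[OF L_refl[OF q]] by simp
        then show "(\<^bold>\<exists>u. (s, u) \<^bold>\<in> h) L q"
          by (intro Ex_I[where x = "ghat s"]) (simp add: h'[OF L_trans[OF _ q]])
      qed
      have c3: "(\<^bold>\<forall>s u v. (s, u) \<^bold>\<in> h \<^bold>\<and> (s, v) \<^bold>\<in> h \<^bold>\<longrightarrow> \<langle>u = v\<rangle>) L r"
        unfolding fAll_def fImp_def fAnd_def fGround_def by (simp add: h')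
      have c4: "(\<^bold>\<forall>s t u v. (s, u) \<^bold>\<in> h \<^bold>\<and> (t, v) \<^bold>\<in> h \<^bold>\<and> \<langle>s \<subseteq> t\<rangle> \<^bold>\<longrightarrow> \<langle>u \<subseteq> v\<rangle>) L r"
        unfolding fAll_def fImp_def fAnd_def fGround_def by (auto simp: h' dest: ghat_mono[OF AR_D(1) _ AR_D(2)])
      have c5: "(\<^bold>\<forall>s t u v. (s, u) \<^bold>\<in> h \<^bold>\<and> (t, v) \<^bold>\<in> h \<^bold>\<and> end_ext k s t \<^bold>\<longrightarrow> \<langle>init_seg u v\<rangle>) L r"
        unfolding fAll_def fImp_def fAnd_def fGround_def
      proof (intro allI impI)
        fix s t u v q assume q: "L q r" and *: "((s, u) \<^bold>\<in> h) L q \<and> ((t, v) \<^bold>\<in> h) L q \<and> end_ext k s t L q"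
        then obtain f m n where "set_tree k f" "m < n" "s = set_approx k f m" "t = set_approx k f n"
          using end_ext_D[OF _ L_refl[OF q]] by blast
        then show "init_seg u v" using * h'[OF q] ghat_init_seg[of f m n] AR_D(2)[of t] by simp
      qed
      have c6: "(\<^bold>\<forall>X S. ?R X S \<^bold>\<longrightarrow>
         (\<^bold>\<forall>i. i \<^bold>\<in> S \<^bold>\<longleftrightarrow>
           (\<^bold>\<exists>n s u. approx k n X s \<^bold>\<and> (s, u) \<^bold>\<in> h \<^bold>\<and> \<langle>i \<in> u\<rangle>))) L r"
        unfolding All_All_Imp_iff All_Iff_iff
      proof (intro allI impI)
        fix X S q i q' assume q: "L q r" "?R X S L q" "L q' q"
        have "L q' Y" by (rule L_trans[OF q(3) L_trans[OF q(1) r]])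
        moreover have "in_B_below k ?Y X L q'" "fgraph g X S L q'"
          using q(2) persistentD[OF persistent_in_B_below _ q(3)] persistentD[OF persistent_graph _ q(3)]
          unfolding R by blast+
        ultimately show "(i \<^bold>\<in> S) L q' \<longleftrightarrow>
            (\<^bold>\<exists>n s u. approx k n X s \<^bold>\<and> (s, u) \<^bold>\<in> h \<^bold>\<and> \<langle>i \<in> u\<rangle>) L q'"
          by (rule value_iff)
      qed
      show "((\<^bold>\<forall>s u. (s, u) \<^bold>\<in> h \<^bold>\<longrightarrow> in_AR_below k ?Y s \<^bold>\<and> \<langle>finite u\<rangle>) \<^bold>\<and>
       (\<^bold>\<forall>s. in_AR_below k ?Y s \<^bold>\<longrightarrow> (\<^bold>\<exists>u. (s, u) \<^bold>\<in> h)) \<^bold>\<and>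
       (\<^bold>\<forall>s u v. (s, u) \<^bold>\<in> h \<^bold>\<and> (s, v) \<^bold>\<in> h \<^bold>\<longrightarrow> \<langle>u = v\<rangle>) \<^bold>\<and>
       (\<^bold>\<forall>s t u v. (s, u) \<^bold>\<in> h \<^bold>\<and> (t, v) \<^bold>\<in> h \<^bold>\<and> \<langle>s \<subseteq> t\<rangle> \<^bold>\<longrightarrow> \<langle>u \<subseteq> v\<rangle>) \<^bold>\<and>
       (\<^bold>\<forall>s t u v. (s, u) \<^bold>\<in> h \<^bold>\<and> (t, v) \<^bold>\<in> h \<^bold>\<and> end_ext k s t \<^bold>\<longrightarrow> \<langle>init_seg u v\<rangle>) \<^bold>\<and>
       (\<^bold>\<forall>X S. ?R X S \<^bold>\<longrightarrow>
         (\<^bold>\<forall>i. i \<^bold>\<in> S \<^bold>\<longleftrightarrow>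
           (\<^bold>\<exists>n s u. approx k n X s \<^bold>\<and> (s, u) \<^bold>\<in> h \<^bold>\<and> \<langle>i \<in> u\<rangle>)))) L r"
        unfolding fAnd_def[of "fAll _"] using c1 c2 c3 c4 c5 c6 by blast
    qed
  qed
qed

end

text \<open>A condition \<open>r\<close> decides the given member of the space to be a ground model
  set \<open>A\<close>. Fusion inside \<open>r \<inter> A\<close> produces \<open>Y\<close>, which
  is at once a condition below \<open>q\<close>, a member of the space and, below itself, a member
  of the generic.\<close>

lemma basic_below:
  assumes "in_E k X L q" "in_G X L q" "L q p"
  shows "\<exists>Y. L Y q \<and> in_B k (check_set Y) L Y \<and>
    basic k (check_set Y) (restrict_graph (in_B_below k (check_set Y)) (fgraph g)) L Y"
proof -
  have q: "L q q" by (rule L_refl[OF assms(3)])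
  obtain q1 A where q1: "L q1 q" "L q1 A" "(X \<^bold>= check_set A) L q1"
    using in_G_D[OF assms(2) q] by blast
  obtain r f where r: "L r q1" "set_tree k f" "(X \<^bold>= check_set (set_range k f)) L r"
    using in_E_D[OF persistentD[OF persistent_in_E assms(1) q1(1)] L_refl[OF q1(1)]] by blast
  have "(check_set A \<^bold>= check_set (set_range k f)) L r"
    by (rule eq_trans[OF eq_sym[OF persistentD[OF persistent_eq q1(3) r(1)]] r(3)])
  then have A: "A = set_range k f" by (rule iffD1[OF eq_check[OF L_refl[OF r(1)]]])
  let ?B = "r \<inter> A"
  have "positive k ?B" by (rule Fin_le_positive_Int[OF k L_trans[OF r(1) q1(2)]])
  moreover have "?B \<subseteq> Wrange k" using set_range_Wrange[OF r(2)] A by blast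
  ultimately obtain F where F: "list_tree k F" "\<And>j. j \<in> nd_le k \<Longrightarrow> set (F j) \<in> W_hat k" "F ` nd k \<subseteq> ?B"
    "\<And>s i x. finite s \<Longrightarrow> s \<subseteq> F ` nd k \<Longrightarrow> x \<in> entries s \<Longrightarrow> i \<le> x \<Longrightarrow> decides k omits (F ` nd k) s i"
    using fusion[OF k, of ?B omits] by blast
  define Y where "Y = F ` nd k"
  have "r \<subseteq> tuples k" using r(1) by (simp add: Fin_le_iff[OF k])
  then have "L Y r" using F(3) list_tree_range_positive[OF F(1)] unfolding Y_def
    by (intro Fin_le_subset[OF k]) auto
  then have Yq: "L Y q" using L_trans[OF _ L_trans[OF r(1) q1(1)]] by blast
  have gt: "set_tree k (\<lambda>j. set (F j))" by (rule list_tree_set_tree[OF k F(1,2)])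
  have "set_range k (\<lambda>j. set (F j)) = Y"
    unfolding set_range_def Y_def
  proof (rule image_cong[OF refl])
    fix j assume "j \<in> nd k"
    then have "sorted_wrt (<) (F j)" using list_tree_sorted[OF F(1)] nd_subset by blast
    then show "sorted_list_of_set (set (F j)) = F j"
      by (simp add: sorted_list_of_set.idem_if_sorted_distinct strict_sorted_iff)
  qed
  then have "in_E k (check_set Y) L Y" using in_E_I[OF gt eq_refl[of _ Y]] by simp
  then have "in_B k (check_set Y) L Y"
    using in_G_check[OF L_refl[OF Yq]] by (simp add: in_B_def fAnd_def)
  moreover have "basic k (check_set Y) (restrict_graph (in_B_below k (check_set Y)) (fgraph g)) L Y"
    by (rule basic_fusion[OF F(1) Y_def L_trans[OF Yq assms(3)] F(4)[folded Y_def]])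
  ultimately show ?thesis using Yq by blast
qed

end

end

theorem theorem37:
  fixes k :: nat
  assumes "2 \<le> k"
  shows "Fin_le k \<tturnstile>
    ((\<^bold>\<exists>X. in_B k X) \<^bold>\<longrightarrow>
     (\<^bold>\<forall>g. monotone_fun in_G (fgraph g) \<^bold>\<longrightarrow>
       (\<^bold>\<exists>Y. in_B k Y \<^bold>\<and> basic k Y (restrict_graph (in_B_below k Y) (fgraph g)))))"
proof -
  have k: "1 \<le> k" using assms by simp
  show ?thesis unfolding forced_def
  proof (intro allI impI)
    fix p
    show "((\<^bold>\<exists>X. in_B k X) \<^bold>\<longrightarrow>
     (\<^bold>\<forall>g. monotone_fun in_G (fgraph g) \<^bold>\<longrightarrow>
       (\<^bold>\<exists>Y. in_B k Y \<^bold>\<and> basic k Y (restrict_graph (in_B_below k Y) (fgraph g))))) (Fin_le k) p"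
      unfolding fImp_def fAll_def
    proof (intro allI impI)
      fix q g q1 assume ex: "(\<^bold>\<exists>X. in_B k X) (Fin_le k) q" and q1: "Fin_le k q1 q"
        and mon: "monotone_fun in_G (fgraph g) (Fin_le k) q1"
      show "(\<^bold>\<exists>Y. in_B k Y \<^bold>\<and> basic k Y (restrict_graph (in_B_below k Y) (fgraph g))) (Fin_le k) q1"
        unfolding fEx_def fAnd_def
      proof (intro allI impI)
        \<comment> \<open>Existence is a density statement: below an arbitrary \<open>q2\<close> the
          premise supplies a member of the space in the generic, and \<open>basic_below\<close> then
          gives a condition that is itself the desired \<open>Y\<close>.\<close>
        fix q2 assume q2: "Fin_le k q2 q1"
        obtain r X where r: "Fin_le k r q2" "in_G X (Fin_le k) r" "in_E k X (Fin_le k) r"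
          using Ex_D[OF k persistentD[OF k persistent_Ex[OF k] ex Fin_le_trans[OF k q2 q1]] Fin_le_refl1[OF q2 k]]
          by (auto simp: in_B_def fAnd_def)
        show "\<exists>r. Fin_le k r q2 \<and> (\<exists>Y. in_B k Y (Fin_le k) r \<and>
            basic k Y (restrict_graph (in_B_below k Y) (fgraph g)) (Fin_le k) r)"
          using basic_below[OF k mon r(3,2) Fin_le_trans[OF k r(1) q2]] Fin_le_trans[OF k _ r(1)] by blast
      qed
    qed
  qed
qed

end
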